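(* Let $\epsilon>0$. Let $G$ be an abelian group, $A\subseteq G$ finite nonempty and $K\ge1$, and suppose $E(A)\ge K^{-1}|A|^3$. Then there exists $A'\subseteq A$ with $|A'|\gg_\epsilon K^{-100/81-\epsilon}|A|$ such that \[|A'-A'|\ll_\epsilon K^{100/27+\epsilon}|A'|.\]
   Context: $E(A)=\#\{(a,b,c,d)\in A^4:a+b=c+d\}$ is the additive energy; $A'-A'=\{a-b:a,b\in A'\}$. $X\ll_\epsilon Y$ (equivalently $Y\gg_\epsilon X$) means $X\le C_\epsilon Y$ with $C_\epsilon$ depending only on $\epsilon$ (not on $G$, $A$, $K$). *)

theory Defs
  imports Complex_Main "HOL-Algebra.Algebra"
begin

text \<open>
  Abelian groups are the locale \<^locale>\<open>comm_group\<close>, whose operation is written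
  multiplicatively; \<open>a + b\<close> and \<open>a - b\<close> thus become \<open>a \<otimes> b\<close> and \<open>a \<otimes> inv b\<close>.
\<close>

definition additive_energy :: "('a, 'b) monoid_scheme \<Rightarrow> 'a set \<Rightarrow> nat" where
  "additive_energy G A =
     card {(a, b, c, d). a \<in> A \<and> b \<in> A \<and> c \<in> A \<and> d \<in> A \<and> a \<otimes>\<^bsub>G\<^esub> b = c \<otimes>\<^bsub>G\<^esub> d}"

definition difference_set :: "('a, 'b) monoid_scheme \<Rightarrow> 'a set \<Rightarrow> 'a set" where
  "difference_set G A = {a \<otimes>\<^bsub>G\<^esub> inv\<^bsub>G\<^esub> b | a b. a \<in> A \<and> b \<in> A}"

text \<open>
  The implied constant \<open>C\<^sub>\<epsilon>\<close> has to be independent of the group, hence also of the type of its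
  elements. A formula \<open>\<exists>C. \<forall>G :: 'a monoid. \<dots>\<close> would let \<open>C\<close> vary with \<open>'a\<close>, and HOL cannot
  quantify over types inside a formula. So the constant is named here, as a function of
  \<open>\<epsilon>\<close> alone: it is some constant that serves all abelian groups with carrier a subset of
  \<^typ>\<open>nat\<close>. These include a copy of every countable abelian group, in particular of the subgroup
  generated by a finite set, so a constant that serves them serves all abelian groups.
  One constant is used for both estimates; the larger of two constants serves for both.
  The positivity of the constant follows from the first estimate.
\<close>

definition energy_const :: "real \<Rightarrow> real" where
  "energy_const \<epsilon> = (SOME C.
     \<forall>(G :: nat monoid) A K.
       comm_group G \<longrightarrow> A \<subseteq> carrier G \<longrightarrow> finite A \<longrightarrow> A \<noteq> {} \<longrightarrow> K \<ge> 1 \<longrightarrow>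
       real (additive_energy G A) \<ge> inverse K * real (card A) ^ 3 \<longrightarrow>
       (\<exists>A'\<subseteq>A.
          K powr (- 100 / 81 - \<epsilon>) * real (card A) \<le> C * real (card A') \<and>
          real (card (difference_set G A')) \<le> C * (K powr (100 / 27 + \<epsilon>) * real (card A'))))"

end

theory Submission
  imports Defs "HOL-Library.Countable_Set" "HOL-Analysis.Convex" "HOL-Real_Asymp.Real_Asymp"
begin

text \<open>
  Let \<open>r(d)\<close> be the number of representations of \<open>d\<close> as a difference of elements of \<open>A\<close>, and let
  \<open>M = K\<close> to the power \<open>50 / 27\<close>. If the sum of \<open>|A \<inter> (x + B)|\<close> cubed over all \<open>x\<close> is at least
  \<open>|A|\<^sup>2 |B|\<^sup>2 / M\<close> for \<open>B = A\<close> or another not too small set \<open>B\<close>, then most of a suitable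
  \<open>A \<inter> (x + B)\<close> can serve as \<open>A'\<close>, by the usual Balog--Szemeredi--Gowers argument. So suppose that all
  these third moments are small. Let \<open>P\<close> be the set of differences with \<open>r(d) \<ge> \<tau>\<close>, where \<open>\<tau>\<close> is a
  level that carries the energy. Counting walks of length three in the graph \<open>x - y \<in> P\<close> on \<open>A\<close>
  bounds \<open>Q\<close>, the sum of \<open>r(\<alpha> - \<beta>)\<^sup>2\<close> over \<open>\<alpha>, \<beta> \<in> P\<close>, from below. The pairs with small or with large
  \<open>r(\<alpha> - \<beta>)\<close> contribute less than that to \<open>Q\<close>, because the third moments are small for \<open>B = P\<close> and for
  the sets \<open>B\<close> of very popular differences. Hence pairs with \<open>r(\<alpha> - \<beta>)\<close> in a middle range dominate.
  Then some \<open>A \<inter> (x + P)\<close> contains many pairs whose difference has \<open>r\<close> in that range, while \<open>r\<close> is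
  not too small for almost all of its pairs, and joining elements by one step of each kind yields
  \<open>A'\<close> after all.
\<close>

subsection \<open>Representation counts\<close>

context comm_group
begin

text \<open>This is \<open>x - y\<close> in additive notation.\<close>

definition quot :: "'a \<Rightarrow> 'a \<Rightarrow> 'a" (infixl "\<oslash>" 70) where
  "x \<oslash> y = x \<otimes> inv y"

lemma quot_closed [simp]: "x \<in> carrier G \<Longrightarrow> y \<in> carrier G \<Longrightarrow> x \<oslash> y \<in> carrier G"
  by (simp add: quot_def)

text \<open>For fixed \<open>x\<close> the map \<open>y \<mapsto> x \<oslash> y\<close> is thus an
  involution, which serves as the witness of several bijections below.\<close>

lemma quot_quot_left [simp]:
  assumes "x \<in> carrier G" "y \<in> carrier G"
  shows "x \<oslash> (x \<oslash> y) = y"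
  using assms by (simp add: quot_def inv_mult_group m_assoc[symmetric] m_comm)

lemma quot_swap:
  assumes "x \<in> carrier G" "y \<in> carrier G" "z \<in> carrier G"
  shows "(x \<oslash> y) \<oslash> z = (x \<oslash> z) \<oslash> y"
  using assms by (simp add: quot_def m_ac)

lemma quot_cancel_right [simp]:
  assumes "x \<in> carrier G" "y \<in> carrier G" "z \<in> carrier G"
  shows "(x \<oslash> z) \<oslash> (y \<oslash> z) = x \<oslash> y"
proof -
  have "(x \<oslash> z) \<oslash> (y \<oslash> z) = (x \<oslash> (y \<oslash> z)) \<oslash> z"
    using assms by (simp add: quot_swap)
  also have "\<dots> = (x \<otimes> inv y) \<otimes> (z \<otimes> inv z)"
    using assms by (simp add: quot_def inv_mult m_assoc del: r_inv)
  finally show ?thesis using assms by (simp add: quot_def)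
qed

lemma quot_cancel_left [simp]:
  assumes "x \<in> carrier G" "y \<in> carrier G" "z \<in> carrier G"
  shows "(x \<oslash> y) \<oslash> (x \<oslash> z) = z \<oslash> y"
  using quot_swap[of x y "x \<oslash> z"] assms by simp

lemma quot_rotate:
  assumes "x \<in> carrier G" "y \<in> carrier G" "z \<in> carrier G"
  shows "x \<oslash> (y \<oslash> z) = z \<oslash> (y \<oslash> x)"
  using assms by (simp add: quot_def inv_mult m_ac)

lemma inv_quot:
  assumes "x \<in> carrier G" "y \<in> carrier G"
  shows "inv (x \<oslash> y) = y \<oslash> x"
  using assms by (simp add: quot_def inv_mult_group)

text \<open>Additively, the size of \<open>B \<inter> (x + C)\<close>. It is also the number of
  representations of \<open>x\<close> as \<open>b \<oslash> c\<close>, since \<open>b\<close>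
  determines \<open>c = b \<oslash> x\<close>.\<close>

definition rep :: "'a set \<Rightarrow> 'a set \<Rightarrow> 'a \<Rightarrow> real" where
  "rep B C x = real (card {b \<in> B. b \<oslash> x \<in> C})"

definition quots :: "'a set \<Rightarrow> 'a set \<Rightarrow> 'a set" where
  "quots B C = (\<lambda>(b, c). b \<oslash> c) ` (B \<times> C)"

lemma difference_set_eq_quots: "difference_set G A = quots A A"
  by (auto simp: difference_set_def quots_def quot_def)

lemma finite_quots [simp]: "finite B \<Longrightarrow> finite C \<Longrightarrow> finite (quots B C)"
  by (simp add: quots_def)

lemma quots_subset: "B \<subseteq> carrier G \<Longrightarrow> C \<subseteq> carrier G \<Longrightarrow> quots B C \<subseteq> carrier G"
  by (force simp: quots_def subset_iff)

lemma quotsI: "b \<in> B \<Longrightarrow> c \<in> C \<Longrightarrow> b \<oslash> c \<in> quots B C"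
  by (auto simp: quots_def)

lemma quotsE:
  assumes "d \<in> quots B C"
  obtains b c where "b \<in> B" "c \<in> C" "d = b \<oslash> c"
  using assms unfolding quots_def by force

lemma rep_nonneg [simp]: "0 \<le> rep B C x"
  by (simp add: rep_def)

lemma rep_le_card: "finite B \<Longrightarrow> rep B C x \<le> card B"
  by (auto simp: rep_def intro: card_mono)

lemma rep_eq_0:
  assumes "B \<subseteq> carrier G" "C \<subseteq> carrier G" "x \<in> carrier G" "x \<notin> quots B C"
  shows "rep B C x = 0"
proof -
  have "b \<oslash> x \<notin> C" if "b \<in> B" for b
    using assms that quotsI[of b B "b \<oslash> x" C] by (metis quot_quot_left subsetD)
  then have "{b \<in> B. b \<oslash> x \<in> C} = {}" by blast
  then show ?thesis by (simp only: rep_def card.empty of_nat_0)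
qed

text \<open>A pair \<open>(b, c)\<close> can be recovered from \<open>b\<close> and its quotient
  \<open>x\<close>, as \<open>c = b \<oslash> x\<close>; so pairs can be grouped by
  quotient.\<close>

lemma sum_fibres:
  fixes f :: "'a \<Rightarrow> 'a \<Rightarrow> real"
  assumes B: "finite B" "B \<subseteq> carrier G" and C: "finite C" "C \<subseteq> carrier G"
  shows "(\<Sum>x\<in>quots B C. \<Sum>b\<in>{b \<in> B. b \<oslash> x \<in> C}. f x b) = (\<Sum>b\<in>B. \<Sum>c\<in>C. f (b \<oslash> c) b)"
proof -
  have "(\<Sum>x\<in>quots B C. \<Sum>b\<in>{b \<in> B. b \<oslash> x \<in> C}. f x b)
      = (\<Sum>(x, b)\<in>Sigma (quots B C) (\<lambda>x. {b \<in> B. b \<oslash> x \<in> C}). f x b)"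
    using B C by (subst sum.Sigma) auto
  also have "\<dots> = (\<Sum>(b, c)\<in>B \<times> C. f (b \<oslash> c) b)"
    using assms quots_subset[OF B(2) C(2)]
    by (intro sum.reindex_bij_witness[where i = "\<lambda>(b, c). (b \<oslash> c, b)" and j = "\<lambda>(x, b). (b, b \<oslash> x)"])
      (auto intro: quotsI simp: subset_iff)
  also have "\<dots> = (\<Sum>b\<in>B. \<Sum>c\<in>C. f (b \<oslash> c) b)"
    using B C by (subst sum.Sigma) auto
  finally show ?thesis .
qed

lemma sum_rep:
  fixes f :: "'a \<Rightarrow> real"
  assumes "finite B" "B \<subseteq> carrier G" "finite C" "C \<subseteq> carrier G"
  shows "(\<Sum>b\<in>B. \<Sum>c\<in>C. f (b \<oslash> c)) = (\<Sum>x\<in>quots B C. rep B C x * f x)"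
  using sum_fibres[OF assms, of "\<lambda>x b. f x"] by (simp add: rep_def)

text \<open>If \<open>\<beta> = a \<oslash> x\<close>, then
  \<open>\<beta> \<oslash> (a \<oslash> b) = b \<oslash> x\<close>. Hence translates of
  \<open>B\<close> that contain both \<open>a\<close> and \<open>b\<close> correspond to
  representations of \<open>a \<oslash> b\<close>.\<close>

lemma rep_card_common:
  assumes B: "finite B" "B \<subseteq> carrier G" and ab: "a \<in> A" "b \<in> A" "A \<subseteq> carrier G"
  shows "rep B B (a \<oslash> b) = real (card {x \<in> quots A B. a \<oslash> x \<in> B \<and> b \<oslash> x \<in> B})"
proof -
  have c: "a \<in> carrier G" "b \<in> carrier G" "quots A B \<subseteq> carrier G"
    using ab B quots_subset by auto
  have "bij_betw (\<lambda>x. a \<oslash> x) {x \<in> quots A B. a \<oslash> x \<in> B \<and> b \<oslash> x \<in> B} {\<beta> \<in> B. \<beta> \<oslash> (a \<oslash> b) \<in> B}"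
    using c B ab
    by (intro bij_betw_byWitness[where f' = "\<lambda>x. a \<oslash> x"])
      (auto intro: quotsI simp: subset_iff quot_rotate[of _ a b])
  then show ?thesis
    using bij_betw_same_card by (fastforce simp: rep_def)
qed

text \<open>Double counting: \<open>rep_card_common\<close> gives the number of fibres that contain
  both \<open>a\<close> and \<open>b\<close>.\<close>

lemma sum_pairs_fibres:
  fixes h :: "'a \<Rightarrow> 'a \<Rightarrow> real"
  assumes A: "finite A" "A \<subseteq> carrier G" and B: "finite B" "B \<subseteq> carrier G"
  shows "(\<Sum>x\<in>quots A B. \<Sum>a\<in>{a \<in> A. a \<oslash> x \<in> B}. \<Sum>b\<in>{a \<in> A. a \<oslash> x \<in> B}. h a b)
       = (\<Sum>a\<in>A. \<Sum>b\<in>A. h a b * rep B B (a \<oslash> b))"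
proof -
  have "(\<Sum>x\<in>quots A B. \<Sum>a\<in>{a \<in> A. a \<oslash> x \<in> B}. \<Sum>b\<in>{a \<in> A. a \<oslash> x \<in> B}. h a b)
      = (\<Sum>x\<in>quots A B. \<Sum>a\<in>A. \<Sum>b\<in>A. h a b * of_bool (a \<oslash> x \<in> B \<and> b \<oslash> x \<in> B))"
  proof (rule sum.cong[OF refl])
    fix x
    show "(\<Sum>a\<in>{a \<in> A. a \<oslash> x \<in> B}. \<Sum>b\<in>{a \<in> A. a \<oslash> x \<in> B}. h a b)
        = (\<Sum>a\<in>A. \<Sum>b\<in>A. h a b * of_bool (a \<oslash> x \<in> B \<and> b \<oslash> x \<in> B))"
      using A by (simp add: sum.inter_filter if_distrib of_bool_def cong: if_cong)
        (auto intro!: sum.cong)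
  qed
  also have "\<dots> = (\<Sum>a\<in>A. \<Sum>b\<in>A. \<Sum>x\<in>quots A B. h a b * of_bool (a \<oslash> x \<in> B \<and> b \<oslash> x \<in> B))"
    by (subst sum.swap, rule sum.cong[OF refl], rule sum.swap)
  also have "\<dots> = (\<Sum>a\<in>A. \<Sum>b\<in>A. h a b * rep B B (a \<oslash> b))"
    using assms by (intro sum.cong refl)
      (simp add: sum_distrib_left[symmetric] rep_card_common[OF B _ _ A(2)] of_bool_def sum.If_cases Int_def)
  finally show ?thesis .
qed

lemma rep_eq_sum:
  assumes "finite B" "B \<subseteq> carrier G" "finite C" "C \<subseteq> carrier G" "x \<in> carrier G"
  shows "rep B C x = (\<Sum>b\<in>B. \<Sum>c\<in>C. of_bool (b \<oslash> c = x))"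
proof -
  have "(\<Sum>c\<in>C. of_bool (b \<oslash> c = x)) = (of_bool (b \<oslash> x \<in> C) :: real)" if "b \<in> B" for b
  proof -
    have "(\<Sum>c\<in>C. of_bool (b \<oslash> c = x)) = (\<Sum>c\<in>C. of_bool (c = b \<oslash> x) :: real)"
      using assms that by (intro sum.cong refl) (auto simp: subset_iff)
    then show ?thesis using assms by (simp add: of_bool_def sum.delta)
  qed
  then show ?thesis
    using assms by (simp add: rep_def of_bool_def sum.If_cases Int_def)
qed

lemma rep_eq_card:
  assumes "finite B" "B \<subseteq> carrier G" "finite C" "C \<subseteq> carrier G" "x \<in> carrier G"
  shows "rep B C x = real (card {p \<in> B \<times> C. fst p \<oslash> snd p = x})"
proof -
  have "bij_betw fst {p \<in> B \<times> C. fst p \<oslash> snd p = x} {b \<in> B. b \<oslash> x \<in> C}"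
    using assms
    by (intro bij_betw_byWitness[where f' = "\<lambda>b. (b, b \<oslash> x)"]) (auto simp: subset_iff)
  then show ?thesis using bij_betw_same_card by (fastforce simp: rep_def)
qed

text \<open>Both sides run over the solutions of
  \<open>a \<oslash> b = \<alpha> \<oslash> \<beta>\<close>, weighted by \<open>g\<close> at the
  common value.\<close>

lemma sum_rep_swap:
  fixes g :: "'a \<Rightarrow> real"
  assumes A: "finite A" "A \<subseteq> carrier G" and B: "finite B" "B \<subseteq> carrier G"
  shows "(\<Sum>a\<in>A. \<Sum>b\<in>A. rep B B (a \<oslash> b) * g (a \<oslash> b))
       = (\<Sum>\<alpha>\<in>B. \<Sum>\<beta>\<in>B. rep A A (\<alpha> \<oslash> \<beta>) * g (\<alpha> \<oslash> \<beta>))" (is "?l = ?r")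
proof -
  have "?l = (\<Sum>a\<in>A. \<Sum>b\<in>A. \<Sum>\<alpha>\<in>B. \<Sum>\<beta>\<in>B. of_bool (\<alpha> \<oslash> \<beta> = a \<oslash> b) * g (a \<oslash> b))"
    using A by (intro sum.cong refl) (simp add: rep_eq_sum[OF B B] subset_iff sum_distrib_right)
  also have "\<dots> = (\<Sum>a\<in>A. \<Sum>\<alpha>\<in>B. \<Sum>b\<in>A. \<Sum>\<beta>\<in>B. of_bool (\<alpha> \<oslash> \<beta> = a \<oslash> b) * g (a \<oslash> b))"
    by (rule sum.cong[OF refl], rule sum.swap)
  also have "\<dots> = (\<Sum>\<alpha>\<in>B. \<Sum>a\<in>A. \<Sum>\<beta>\<in>B. \<Sum>b\<in>A. of_bool (\<alpha> \<oslash> \<beta> = a \<oslash> b) * g (a \<oslash> b))"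
    by (subst sum.swap, rule sum.cong[OF refl], rule sum.cong[OF refl], rule sum.swap)
  also have "\<dots> = (\<Sum>\<alpha>\<in>B. \<Sum>\<beta>\<in>B. \<Sum>a\<in>A. \<Sum>b\<in>A. of_bool (\<alpha> \<oslash> \<beta> = a \<oslash> b) * g (a \<oslash> b))"
    by (rule sum.cong[OF refl], rule sum.swap)
  also have "\<dots> = (\<Sum>\<alpha>\<in>B. \<Sum>\<beta>\<in>B. \<Sum>a\<in>A. \<Sum>b\<in>A. of_bool (a \<oslash> b = \<alpha> \<oslash> \<beta>) * g (\<alpha> \<oslash> \<beta>))"
    by (intro sum.cong refl) (auto simp: of_bool_def)
  also have "\<dots> = ?r"
    using B by (intro sum.cong refl) (simp add: rep_eq_sum[OF A A] subset_iff sum_distrib_right)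
  finally show ?thesis .
qed

lemma rep_quot_commute:
  assumes "finite A" "A \<subseteq> carrier G" "x \<in> carrier G" "y \<in> carrier G"
  shows "rep A A (x \<oslash> y) = rep A A (y \<oslash> x)"
proof -
  have *: "a \<oslash> b = x \<oslash> y \<longleftrightarrow> b \<oslash> a = y \<oslash> x" if "a \<in> A" "b \<in> A" for a b
    using assms that by (metis inv_quot subsetD)
  have "rep A A (x \<oslash> y) = (\<Sum>a\<in>A. \<Sum>b\<in>A. of_bool (a \<oslash> b = x \<oslash> y))"
    using assms by (intro rep_eq_sum) auto
  also have "\<dots> = (\<Sum>a\<in>A. \<Sum>b\<in>A. of_bool (b \<oslash> a = y \<oslash> x))"
    using * by (intro sum.cong refl) auto
  also have "\<dots> = rep A A (y \<oslash> x)"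
    using assms by (subst sum.swap, subst rep_eq_sum) auto
  finally show ?thesis .
qed

text \<open>Every \<open>y \<oslash> z\<close> is written as \<open>(y \<oslash> w) \<oslash> (z \<oslash> w)\<close> for many \<open>w\<close>.\<close>
lemma card_quots_paths:
  fixes m \<theta> \<theta>' :: real
  assumes C: "finite C" "C \<subseteq> carrier G" and W: "finite W" "W \<subseteq> carrier G"
    and Y: "finite Y" "Y \<subseteq> carrier G" and pos: "0 \<le> \<theta>" "0 \<le> \<theta>'"
    and paths: "\<And>y z. y \<in> Y \<Longrightarrow> z \<in> Y \<Longrightarrow>
      m \<le> card {w \<in> W. \<theta> \<le> rep C C (y \<oslash> w) \<and> \<theta>' \<le> rep C C (z \<oslash> w)}"
  shows "card (quots Y Y) * (m * (\<theta> * \<theta>')) \<le> card C ^ 4"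
proof -
  \<comment> \<open>These sets are disjoint for different \<open>d\<close> and lie in the fourth
    power of \<open>C\<close>, so a lower bound for each of them is enough.\<close>
  define S where "S d = {p \<in> (C \<times> C) \<times> (C \<times> C).
    (fst (fst p) \<oslash> snd (fst p)) \<oslash> (fst (snd p) \<oslash> snd (snd p)) = d}" for d
  have lower: "m * (\<theta> * \<theta>') \<le> card (S d)" if "d \<in> quots Y Y" for d
  proof -
    obtain y z where yz: "y \<in> Y" "z \<in> Y" "d = y \<oslash> z"
      using \<open>d \<in> quots Y Y\<close> by (blast elim: quotsE)
    define V where "V = {w \<in> W. \<theta> \<le> rep C C (y \<oslash> w) \<and> \<theta>' \<le> rep C C (z \<oslash> w)}"
    define F where "F v = {p \<in> C \<times> C. fst p \<oslash> snd p = v}" for v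
    have finF: "finite (F v)" for v using C by (simp add: F_def)
    \<comment> \<open>Distinct \<open>w\<close> give distinct first quotients, so the sets of
      quadruples that they produce are disjoint.\<close>
    have inj: "w = w'" if "w \<in> V" "w' \<in> V" "y \<oslash> w = y \<oslash> w'" for w w'
    proof -
      have "w \<in> carrier G" "w' \<in> carrier G" "y \<in> carrier G"
        using that yz W Y by (auto simp: V_def)
      then show ?thesis using that(3) by (metis quot_quot_left)
    qed
    have "m * (\<theta> * \<theta>') \<le> card V * (\<theta> * \<theta>')"
      using paths[OF yz(1,2)] pos by (intro mult_right_mono) (auto simp: V_def)
    also have "\<dots> = (\<Sum>w\<in>V. \<theta> * \<theta>')" by simp
    also have "\<dots> \<le> (\<Sum>w\<in>V. real (card (F (y \<oslash> w) \<times> F (z \<oslash> w))))"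
    proof (intro sum_mono)
      fix w assume w: "w \<in> V"
      then have "y \<oslash> w \<in> carrier G" "z \<oslash> w \<in> carrier G"
        using yz W Y by (auto simp: V_def subset_iff)
      then have "rep C C (y \<oslash> w) = card (F (y \<oslash> w))" "rep C C (z \<oslash> w) = card (F (z \<oslash> w))"
        using rep_eq_card[OF C C] by (auto simp: F_def)
      then show "\<theta> * \<theta>' \<le> card (F (y \<oslash> w) \<times> F (z \<oslash> w))"
        using w pos by (auto simp: V_def card_cartesian_product intro!: mult_mono)
    qed
    also have "\<dots> = card (\<Union>w\<in>V. F (y \<oslash> w) \<times> F (z \<oslash> w))"
    proof (subst card_UN_disjoint)
      show "finite V" using W by (simp add: V_def)
      show "\<forall>w\<in>V. \<forall>w'\<in>V. w \<noteq> w' \<longrightarrow>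
          F (y \<oslash> w) \<times> F (z \<oslash> w) \<inter> F (y \<oslash> w') \<times> F (z \<oslash> w') = {}"
        using inj by (fastforce simp: F_def)
    qed (use finF in auto)
    also have "\<dots> \<le> card (S d)"
    proof -
      have "(\<Union>w\<in>V. F (y \<oslash> w) \<times> F (z \<oslash> w)) \<subseteq> S d"
      proof (clarsimp simp: F_def S_def)
        fix a b c e w
        assume "a \<oslash> b = y \<oslash> w" "c \<oslash> e = z \<oslash> w" "w \<in> V"
        then show "(y \<oslash> w) \<oslash> (z \<oslash> w) = d"
          using yz W Y by (auto simp: V_def subset_iff)
      qed
      moreover have "finite (S d)" using C by (simp add: S_def)
      ultimately show ?thesis by (simp add: card_mono)
    qed
    finally show ?thesis .
  qed
  have "card (quots Y Y) * (m * (\<theta> * \<theta>')) = (\<Sum>d\<in>quots Y Y. m * (\<theta> * \<theta>'))" by simp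
  also have "\<dots> \<le> (\<Sum>d\<in>quots Y Y. real (card (S d)))"
    using lower by (intro sum_mono)
  also have "\<dots> = card (\<Union>d\<in>quots Y Y. S d)"
    using Y C by (subst card_UN_disjoint) (auto simp: S_def)
  also have "\<dots> \<le> card ((C \<times> C) \<times> (C \<times> C))"
    using C by (intro of_nat_mono card_mono) (auto simp: S_def)
  also have "\<dots> = card C ^ 4"
    by (simp add: card_cartesian_product power4_eq_xxxx)
  finally show ?thesis .
qed

end

subsection \<open>Large third moments\<close>

lemma markov_card:
  fixes f :: "'b \<Rightarrow> real" and D :: real
  assumes "finite S" "\<And>y. y \<in> S \<Longrightarrow> 0 \<le> f y"
  shows "card {y \<in> S. D < f y} * D \<le> (\<Sum>y\<in>S. f y)"
proof -
  have "card {y \<in> S. D < f y} * D = (\<Sum>y\<in>{y \<in> S. D < f y}. D)" by simp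
  also have "\<dots> \<le> (\<Sum>y\<in>{y \<in> S. D < f y}. f y)" by (intro sum_mono) auto
  also have "\<dots> \<le> (\<Sum>y\<in>S. f y)" using assms by (intro sum_mono2) auto
  finally show ?thesis .
qed

lemma sum_of_bool_eq_card:
  "finite S \<Longrightarrow> (\<Sum>y\<in>S. of_bool (R y)) = real (card {y \<in> S. R y})"
  by (simp add: of_bool_def sum.If_cases Int_def)

lemma dyadic_interval:
  fixes y F :: real
  assumes "0 < J" "F / 2 ^ J \<le> y" "y \<le> F"
  shows "\<exists>j<J. F / 2 ^ Suc j \<le> y \<and> y \<le> F / 2 ^ j"
  using assms
proof (induction J)
  case (Suc J)
  show ?case
  proof (cases "J = 0 \<or> y \<le> F / 2 ^ J")
    case True
    then show ?thesis using Suc.prems by (intro exI[of _ J]) auto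
  next
    case False
    then obtain j where "j < J" "F / 2 ^ Suc j \<le> y \<and> y \<le> F / 2 ^ j"
      using Suc by fastforce
    then show ?thesis by (intro exI[of _ j]) auto
  qed
qed simp

text \<open>If every level fell short of a share \<open>1 / J\<close>, all levels together would
  fall short of the total. Level sets are bounded only from below, so that they can become sets of
  popular quotients; their overlap does no harm in an upper bound.\<close>

lemma dyadic_pigeonhole:
  fixes f w :: "'b \<Rightarrow> real"
  assumes S: "finite S" and w: "\<And>y. y \<in> S \<Longrightarrow> 0 \<le> w y" and "0 < F" "0 < J"
    and f: "\<And>y. y \<in> S \<Longrightarrow> f y = 0 \<or> F / 2 ^ J \<le> f y \<and> f y \<le> F"
  shows "\<exists>j<J. (\<Sum>y\<in>S. w y * f y) \<le> J * (F / 2 ^ j * (\<Sum>y | y \<in> S \<and> F / 2 ^ Suc j \<le> f y. w y))"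
proof (rule ccontr)
  define t where "t j = F / 2 ^ j * (\<Sum>y | y \<in> S \<and> F / 2 ^ Suc j \<le> f y. w y)" for j
  assume "\<not> ?thesis"
  then have small: "J * t j < (\<Sum>y\<in>S. w y * f y)" if "j < J" for j
    using that by (auto simp: t_def not_le)
  have t_eq: "t j = (\<Sum>y\<in>S. w y * (if F / 2 ^ Suc j \<le> f y then F / 2 ^ j else 0))" for j
    using S by (simp add: t_def sum_distrib_left sum.inter_filter if_distrib mult.commute cong: if_cong)
  have "(\<Sum>y\<in>S. w y * f y) \<le> (\<Sum>y\<in>S. w y * (\<Sum>j<J. if F / 2 ^ Suc j \<le> f y then F / 2 ^ j else 0))"
  proof (intro sum_mono mult_left_mono w)
    fix y assume y: "y \<in> S"
    let ?g = "\<lambda>j. if F / 2 ^ Suc j \<le> f y then F / 2 ^ j else 0"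
    have nn: "0 \<le> ?g j" for j using \<open>0 < F\<close> by simp
    show "f y \<le> (\<Sum>j<J. ?g j)"
    proof (cases "f y = 0")
      case True
      then show ?thesis using nn by (simp add: sum_nonneg)
    next
      case False
      then obtain j where j: "j < J" "F / 2 ^ Suc j \<le> f y" "f y \<le> F / 2 ^ j"
        using dyadic_interval[of J F "f y"] f[OF y] \<open>0 < J\<close> by auto
      then have "f y \<le> ?g j" by simp
      also have "\<dots> \<le> (\<Sum>j<J. ?g j)"
        using j nn by (intro member_le_sum) auto
      finally show ?thesis .
    qed
  qed
  also have "\<dots> = (\<Sum>j<J. t j)"
    unfolding t_eq sum_distrib_left by (rule sum.swap)
  finally have "J * (\<Sum>y\<in>S. w y * f y) \<le> (\<Sum>j<J. J * t j)"
    by (simp add: sum_distrib_left[symmetric] mult_left_mono)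
  also have "\<dots> < (\<Sum>j<J. (\<Sum>y\<in>S. w y * f y))"
    using small \<open>0 < J\<close> by (intro sum_strict_mono) auto
  finally show False by simp
qed

text \<open>Averaging. Applied to a linear combination, it yields one \<open>x\<close> that
  satisfies several inequalities at once.\<close>

lemma sum_pos_imp_ex:
  fixes f :: "'b \<Rightarrow> real"
  assumes "0 < (\<Sum>x\<in>S. f x)"
  shows "\<exists>x\<in>S. 0 < f x"
  using assms by (metis not_le sum_nonpos)

section \<open>Structured subsets inside a fibre\<close>

context comm_group
begin

lemma rep_pos:
  assumes "finite A" "A \<subseteq> carrier G" "a \<in> A" "b \<in> A"
  shows "1 \<le> rep A A (a \<oslash> b)"
proof -
  have "a \<in> {c \<in> A. c \<oslash> (a \<oslash> b) \<in> A}" using assms by (auto simp: subset_iff)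
  then have "{c \<in> A. c \<oslash> (a \<oslash> b) \<in> A} \<noteq> {}" by blast
  then have "card {c \<in> A. c \<oslash> (a \<oslash> b) \<in> A} \<noteq> 0" using assms by simp
  then show ?thesis unfolding rep_def by linarith
qed

lemma sum_rep_le:
  assumes B: "finite B" "B \<subseteq> carrier G" and C: "finite C" "C \<subseteq> carrier G"
    and D: "finite D" "D \<subseteq> carrier G"
  shows "(\<Sum>x\<in>D. rep B C x) \<le> card B * card C"
proof -
  have "(\<Sum>x\<in>D. rep B C x) = (\<Sum>x\<in>D \<inter> quots B C. rep B C x)"
    using D rep_eq_0[OF B(2) C(2)] by (intro sum.mono_neutral_right) auto
  also have "\<dots> \<le> (\<Sum>x\<in>quots B C. rep B C x)"
    using B C by (intro sum_mono2) auto
  also have "\<dots> = card B * card C"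
    using sum_rep[OF B C, of "\<lambda>_. 1"] by simp
  finally show ?thesis .
qed

lemma sum_rep_eq:
  assumes B: "finite B" "B \<subseteq> carrier G" and C: "finite C" "C \<subseteq> carrier G"
  shows "(\<Sum>x\<in>quots B C. rep B C x) = card B * card C"
  using sum_rep[OF assms, of "\<lambda>_. 1"] by simp

text \<open>The set \<open>A'\<close> lies in \<open>F x = {a \<in> A. a \<oslash> x \<in> B}\<close> for some \<open>x\<close>. When \<open>x\<close> is chosen with weight
  \<open>card (F x)\<close>, few pairs from \<open>F x\<close> are expected to have a quotient with few representations.\<close>
lemma large_third_moment_imp_structure:
  fixes \<kappa> :: real
  assumes A: "finite A" "A \<subseteq> carrier G" and B: "finite B" "B \<subseteq> carrier G" and "0 < \<kappa>"
    and ne: "A \<noteq> {}" "B \<noteq> {}"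
    and large: "\<kappa> * real (card A) ^ 2 * real (card B) ^ 2 \<le> (\<Sum>x\<in>quots A B. rep A B x ^ 3)"
  shows "\<exists>A'\<subseteq>A. \<kappa> * card A * card B \<le> 16 * real (card A') ^ 2
           \<and> card (quots A' A') * \<kappa> ^ 2 \<le> 1024 * real (card A')"
proof -
  define n b where "n = real (card A)" and "b = real (card B)"
  have n: "n > 0" and b: "b > 0" using A B ne by (auto simp: n_def b_def card_gt_0_iff)
  \<comment> \<open>With the divisor 16, the term \<open>8 * bads x\<close> below uses up half of
    the lower bound in \<open>large\<close>; the term \<open>s\<close> uses up a further
    quarter.\<close>
  define T where "T = \<kappa> * n ^ 2 / 16"
  have T: "T > 0" using n \<open>0 < \<kappa>\<close> by (simp add: T_def)
  define F where "F x = {a \<in> A. a \<oslash> x \<in> B}" for x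
  define r where "r x = rep A B x" for x
  have r: "r x = card (F x)" for x by (simp add: r_def rep_def F_def)
  \<comment> \<open>The threshold \<open>T / r x\<close> falls as the fibre grows, which cancels the
    weight \<open>r x\<close> in the next sum.\<close>
  define bad where "bad x a c \<longleftrightarrow> rep A A (a \<oslash> c) * r x < T" for x a c
  define bads where "bads x = (\<Sum>a\<in>F x. \<Sum>c\<in>F x. of_bool (bad x a c) :: real)" for x
  let ?X = "quots A B"
  have "(\<Sum>x\<in>?X. r x * bads x) \<le> (\<Sum>x\<in>?X. \<Sum>a\<in>F x. \<Sum>c\<in>F x. T / rep A A (a \<oslash> c))"
    unfolding bads_def sum_distrib_left
  proof (intro sum_mono)
    fix x a c assume "a \<in> F x" "c \<in> F x"
    then have "1 \<le> rep A A (a \<oslash> c)" using rep_pos[OF A] by (auto simp: F_def)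
    then show "r x * of_bool (bad x a c) \<le> T / rep A A (a \<oslash> c)"
      using T by (auto simp: bad_def field_simps of_bool_def)
  qed
  also have "\<dots> = (\<Sum>a\<in>A. \<Sum>c\<in>A. T / rep A A (a \<oslash> c) * rep B B (a \<oslash> c))"
    unfolding F_def by (rule sum_pairs_fibres[OF A B])
  also have "\<dots> = (\<Sum>d\<in>quots A A. rep A A d * (T / rep A A d * rep B B d))"
    by (rule sum_rep[OF A A])
  also have "\<dots> \<le> (\<Sum>d\<in>quots A A. T * rep B B d)"
    using T by (intro sum_mono) auto
  also have "\<dots> \<le> T * (b * b)"
    using sum_rep_le[OF B B finite_quots[OF A(1) A(1)] quots_subset[OF A(2) A(2)]] T
    by (simp add: sum_distrib_left[symmetric] b_def)
  finally have bads: "(\<Sum>x\<in>?X. r x * bads x) \<le> T * (b * b)" .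
  have sum_r: "(\<Sum>x\<in>?X. r x) = n * b"
    using sum_rep_eq[OF A B] by (simp add: r_def n_def b_def)
  define s where "s = \<kappa> * n * b / 4"
  have "(\<Sum>x\<in>?X. r x * (r x ^ 2 - 8 * bads x - s))
      = (\<Sum>x\<in>?X. r x ^ 3) - 8 * (\<Sum>x\<in>?X. r x * bads x) - s * (\<Sum>x\<in>?X. r x)"
    by (simp add: algebra_simps sum_subtractf sum.distrib sum_distrib_left power2_eq_square
        power3_eq_cube)
  also have "\<dots> \<ge> \<kappa> * n ^ 2 * b ^ 2 - 8 * (T * (b * b)) - s * (n * b)"
    using bads sum_r large by (simp add: r_def n_def b_def)
  also have "\<kappa> * n ^ 2 * b ^ 2 - 8 * (T * (b * b)) - s * (n * b) = \<kappa> * n ^ 2 * b ^ 2 / 4"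
    by (simp add: T_def s_def field_simps power2_eq_square)
  finally have "0 < (\<Sum>x\<in>?X. r x * (r x ^ 2 - 8 * bads x - s))"
    using n b \<open>0 < \<kappa>\<close> by (smt (verit) divide_pos_pos mult_pos_pos zero_less_power)
  then obtain x where x: "x \<in> ?X" and "0 < r x * (r x ^ 2 - 8 * bads x - s)"
    using sum_pos_imp_ex by blast
  moreover have "0 \<le> r x" by (simp add: r_def)
  ultimately have rx: "0 < r x" and rx2: "8 * bads x + s < r x ^ 2"
    by (auto simp: zero_less_mult_iff)
  define deg where "deg a = (\<Sum>c\<in>F x. of_bool (bad x a c) :: real)" for a
  have finF: "finite (F x)" using A by (simp add: F_def)
  \<comment> \<open>There are fewer than \<open>r x ^ 2 / 8\<close> bad pairs, so by Markov less
    than half of the fibre is removed.\<close>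
  define Y where "Y = F x - {a \<in> F x. r x / 4 < deg a}"
  have YA: "Y \<subseteq> A" by (auto simp: Y_def F_def)
  have bads0: "0 \<le> bads x" by (auto simp: bads_def intro!: sum_nonneg)
  have s0: "0 < s" using n b \<open>0 < \<kappa>\<close> by (simp add: s_def)
  have "card {a \<in> F x. r x / 4 < deg a} * (r x / 4) \<le> (\<Sum>a\<in>F x. deg a)"
    by (rule markov_card[OF finF]) (auto simp: deg_def intro: sum_nonneg)
  also have "\<dots> < r x ^ 2 / 8" using rx2 s0 by (simp add: bads_def deg_def)
  finally have "card {a \<in> F x. r x / 4 < deg a} < r x / 2"
    using rx by (simp add: field_simps power2_eq_square)
  then have Y2: "r x / 2 \<le> card Y"
    using finF card_mono[OF finF, of "{a \<in> F x. r x / 4 < deg a}"] unfolding Y_def r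
    by (subst card_Diff_subset) auto
  have Yc: "finite Y" "Y \<subseteq> carrier G" using YA A finite_subset by auto
  have Fc: "F x \<subseteq> carrier G" using A by (auto simp: F_def)
  \<comment> \<open>Each of two points of \<open>Y\<close> forms bad pairs with at most a quarter of
    the fibre, so at least half of it can serve as intermediate points.\<close>
  have "card (quots Y Y) * (r x / 2 * (T / r x * (T / r x))) \<le> card A ^ 4"
  proof (rule card_quots_paths[OF A finF Fc Yc])
    fix y z assume y: "y \<in> Y" and z: "z \<in> Y"
    have d: "card {w \<in> F x. bad x a w} \<le> r x / 4" if "a \<in> Y" for a
      using that by (auto simp: Y_def deg_def sum_of_bool_eq_card[OF finF])
    let ?W = "{w \<in> F x. T / r x \<le> rep A A (y \<oslash> w) \<and> T / r x \<le> rep A A (z \<oslash> w)}"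
    have "F x \<subseteq> ?W \<union> ({w \<in> F x. bad x y w} \<union> {w \<in> F x. bad x z w})"
      using rx by (auto simp: bad_def field_simps)
    then have "card (F x) \<le> card (?W \<union> ({w \<in> F x. bad x y w} \<union> {w \<in> F x. bad x z w}))"
      using finF by (intro card_mono) auto
    also have "\<dots> \<le> card ?W + card ({w \<in> F x. bad x y w} \<union> {w \<in> F x. bad x z w})"
      by (rule card_Un_le)
    also have "\<dots> \<le> card ?W + (card {w \<in> F x. bad x y w} + card {w \<in> F x. bad x z w})"
      by (intro add_left_mono card_Un_le)
    finally show "r x / 2 \<le> card ?W" using d[OF y] d[OF z] r[of x] by linarith
  qed (use T rx in auto)
  then have "card (quots Y Y) * \<kappa> ^ 2 \<le> 512 * r x"
    using rx n by (simp add: T_def n_def[symmetric] field_simps power2_eq_square power4_eq_xxxx)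
  moreover have "\<kappa> * n * b / 4 \<le> (2 * real (card Y)) ^ 2"
  proof -
    have "\<kappa> * n * b / 4 \<le> r x ^ 2" using rx2 bads0 by (simp add: s_def)
    also have "\<dots> \<le> (2 * real (card Y)) ^ 2" using Y2 rx by (intro power_mono) auto
    finally show ?thesis .
  qed
  ultimately show ?thesis using YA Y2
    by (intro exI[of _ Y]) (auto simp: n_def b_def power2_eq_square)
qed

text \<open>In \<open>F x = {a \<in> A. a \<oslash> x \<in> P}\<close> a possibly small proportion of the pairs has a quotient with at
  least \<open>\<theta>\<close> representations, but nearly all pairs have a quotient with at least \<open>\<theta>'\<close> of them, where
  \<open>\<theta>'\<close> is much smaller. So paths of length two with one step of each kind join all pairs of a
  large subset, which is more efficient than two steps of the second kind.\<close>
lemma two_scale_structure: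
  fixes \<theta> V :: real and J :: nat
  assumes A: "finite A" "A \<subseteq> carrier G" and P: "finite P" "P \<subseteq> carrier G"
    and ne: "A \<noteq> {}" "P \<noteq> {}" and pos: "0 < \<theta>" "0 < V" "0 < J"
    and V: "V \<le> (\<Sum>a\<in>A. \<Sum>b\<in>A. of_bool (\<theta> \<le> rep A A (a \<oslash> b)) * rep P P (a \<oslash> b))"
    and J: "8 * real (card A) ^ 2 * card P \<le> 2 ^ J * V"
  shows "\<exists>Y\<subseteq>A. V \<le> 32 * J * card A * card P * card Y
           \<and> card (quots Y Y) * (V ^ 3 * \<theta>)
               \<le> 16384 * real J ^ 2 * real (card A) ^ 6 * real (card P) ^ 4 * card Y"
proof -
  define n p where "n = real (card A)" and "p = real (card P)"
  have n: "n > 0" and p: "p > 0" using A P ne by (auto simp: n_def p_def card_gt_0_iff)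
  \<comment> \<open>Chosen such that \<open>16 * J\<close> times the number of bad pairs, summed
    over all fibres, is at most \<open>V / 4\<close>.\<close>
  define \<theta>' where "\<theta>' = V / (64 * J * p ^ 2)"
  have \<theta>': "\<theta>' > 0" using pos p by (simp add: \<theta>'_def)
  define F where "F x = {a \<in> A. a \<oslash> x \<in> P}" for x
  have finF: "finite (F x)" for x using A by (simp add: F_def)
  define r where "r x = rep A P x" for x
  have r: "r x = card (F x)" for x by (simp add: r_def rep_def F_def)
  define good where "good x = (\<Sum>a\<in>F x. \<Sum>c\<in>F x. of_bool (\<theta> \<le> rep A A (a \<oslash> c)) :: real)" for x
  define bad where "bad x = (\<Sum>a\<in>F x. \<Sum>c\<in>F x. of_bool (rep A A (a \<oslash> c) < \<theta>') :: real)" for x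
  let ?X = "quots A P"
  have good: "V \<le> (\<Sum>x\<in>?X. good x)"
    unfolding good_def F_def sum_pairs_fibres[OF A P] by (rule V)
  have "(\<Sum>x\<in>?X. bad x) = (\<Sum>a\<in>A. \<Sum>c\<in>A. of_bool (rep A A (a \<oslash> c) < \<theta>') * rep P P (a \<oslash> c))"
    unfolding bad_def F_def by (rule sum_pairs_fibres[OF A P])
  also have "\<dots> = (\<Sum>d\<in>quots A A. rep A A d * (of_bool (rep A A d < \<theta>') * rep P P d))"
    by (rule sum_rep[OF A A])
  also have "\<dots> \<le> (\<Sum>d\<in>quots A A. \<theta>' * rep P P d)"
    using \<theta>' by (intro sum_mono) (auto simp: of_bool_def intro: mult_right_mono)
  also have "\<dots> \<le> \<theta>' * (p * p)"
    using sum_rep_le[OF P P finite_quots[OF A(1) A(1)] quots_subset[OF A(2) A(2)]] \<theta>'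
    by (simp add: sum_distrib_left[symmetric] p_def)
  also have "\<dots> = V / (64 * J)" using p by (simp add: \<theta>'_def power2_eq_square)
  finally have bad: "(\<Sum>x\<in>?X. bad x) \<le> V / (64 * J)" .
  have sum_r: "(\<Sum>x\<in>?X. r x) = n * p"
    using sum_rep_eq[OF A P] by (simp add: r_def n_def p_def)
  \<comment> \<open>Each subtracted sum is at most \<open>V / 4\<close>. For the \<open>x\<close>
    obtained, the first term forces a large fibre, and the second keeps bad pairs rare even compared
    with a single dyadic level of degrees.\<close>
  have "(\<Sum>x\<in>?X. good x - V / (4 * n * p) * r x - 16 * J * bad x)
      = (\<Sum>x\<in>?X. good x) - V / (4 * n * p) * (\<Sum>x\<in>?X. r x) - 16 * J * (\<Sum>x\<in>?X. bad x)"
    by (simp add: sum_subtractf sum_distrib_left)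
  also have "\<dots> \<ge> V - V / 4 - V / 4"
  proof -
    have "V / (4 * n * p) * (\<Sum>x\<in>?X. r x) = V / 4" using n p sum_r by simp
    moreover have "16 * J * (\<Sum>x\<in>?X. bad x) \<le> V / 4"
      using bad pos by (simp add: field_simps)
    ultimately show ?thesis using good by linarith
  qed
  finally have "0 < (\<Sum>x\<in>?X. good x - V / (4 * n * p) * r x - 16 * J * bad x)"
    using pos by simp
  then obtain x where "x \<in> ?X" and "0 < good x - V / (4 * n * p) * r x - 16 * J * bad x"
    using sum_pos_imp_ex by blast
  define g b where "g = good x" and "b = r x"
  have b0: "0 \<le> b" by (simp add: b_def r_def)
  have bad0: "0 \<le> bad x" by (auto simp: bad_def intro!: sum_nonneg)
  have g_b: "V / (4 * n * p) * b < g" and g_bad: "16 * J * bad x < g"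
  proof -
    have "0 \<le> V / (4 * n * p) * b" "0 \<le> 16 * J * bad x" using b0 bad0 pos n p by auto
    then show "V / (4 * n * p) * b < g" "16 * J * bad x < g"
      using \<open>0 < good x - V / (4 * n * p) * r x - 16 * J * bad x\<close> unfolding g_def b_def
      by linarith+
  qed
  have g_le: "g \<le> b * b"
  proof -
    have "g \<le> (\<Sum>a\<in>F x. \<Sum>c\<in>F x. 1)" unfolding g_def good_def by (intro sum_mono) auto
    then show ?thesis by (simp add: b_def r)
  qed
  have b: "0 < b" using g_le g_b b0 by (cases "b = 0") auto
  have b_n: "b \<le> n" using rep_le_card[OF A(1)] by (simp add: b_def r_def n_def)
  have b_V: "V / (4 * n * p) < b"
    using g_le g_b b by (smt (verit) mult_less_cancel_right_pos)
  have g0: "0 < g" using g_b b pos n p by (smt (verit) divide_pos_pos mult_pos_pos)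
  define deg where "deg a = (\<Sum>c\<in>F x. of_bool (\<theta> \<le> rep A A (a \<oslash> c)) :: real)" for a
  define bdeg where "bdeg a = (\<Sum>c\<in>F x. of_bool (rep A A (a \<oslash> c) < \<theta>') :: real)" for a
  have deg_le: "deg a \<le> b" for a
    unfolding deg_def b_def r by (rule order_trans[OF sum_mono[where g = "\<lambda>_. 1"]]) auto
  \<comment> \<open>Degrees below \<open>b / 2 ^ J\<close> are cut off; by the assumption on
    \<open>2 ^ J\<close> they account for at most half of \<open>g\<close>.\<close>
  define f where "f a = (if b / 2 ^ J \<le> deg a then deg a else 0)" for a
  have "b * b / 2 ^ J \<le> g / 2"
  proof -
    have "8 * n * n * p \<le> 2 ^ J * V" using J by (simp add: n_def p_def power2_eq_square mult_ac)
    then have "2 * n / 2 ^ J \<le> V / (4 * n * p)" using n p by (simp add: field_simps)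
    then have "2 * n / 2 ^ J * b \<le> V / (4 * n * p) * b" using b by (intro mult_right_mono) auto
    moreover have "2 * b / 2 ^ J * b \<le> 2 * n / 2 ^ J * b"
      using b_n b by (intro mult_right_mono divide_right_mono) auto
    ultimately show ?thesis using g_b by simp
  qed
  moreover have "g \<le> (\<Sum>a\<in>F x. f a) + b * b / 2 ^ J"
  proof -
    have "g = (\<Sum>a\<in>F x. deg a)" by (simp add: g_def good_def deg_def)
    also have "\<dots> \<le> (\<Sum>a\<in>F x. f a + b / 2 ^ J)"
      using b by (intro sum_mono) (auto simp: f_def)
    finally show ?thesis by (simp add: sum.distrib b_def r)
  qed
  ultimately have "g / 2 \<le> (\<Sum>a\<in>F x. 1 * f a)" unfolding mult_1 by linarith
  moreover have "\<exists>j<J. (\<Sum>a\<in>F x. 1 * f a)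
      \<le> J * (b / 2 ^ j * (\<Sum>y | y \<in> F x \<and> b / 2 ^ Suc j \<le> f y. 1))"
    using b pos deg_le by (intro dyadic_pigeonhole) (auto simp: finF f_def)
  then obtain j where "j < J" "(\<Sum>a\<in>F x. 1 * f a)
      \<le> J * (b / 2 ^ j * (\<Sum>y | y \<in> F x \<and> b / 2 ^ Suc j \<le> f y. 1))"
    by blast
  ultimately have j: "j < J" "g / 2 \<le> J * (b / 2 ^ j * card {y \<in> F x. b / 2 ^ Suc j \<le> f y})"
    by (simp_all only: real_of_card)
  \<comment> \<open>The lower end of the chosen range of degrees.\<close>
  define D where "D = b / 2 ^ Suc j"
  have D: "0 < D" using b by (simp add: D_def)
  have D_b: "D \<le> b"
  proof -
    have "b / 2 ^ Suc j \<le> b / 1" using b by (intro divide_left_mono) (auto simp del: power_Suc)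
    then show ?thesis by (simp add: D_def)
  qed
  define Y0 where "Y0 = {y \<in> F x. D \<le> deg y}"
  have Y0: "g / (4 * J) \<le> D * card Y0"
  proof -
    have "{y \<in> F x. b / 2 ^ Suc j \<le> f y} \<subseteq> Y0"
      using D by (auto simp: Y0_def D_def f_def split: if_splits)
    then have "card {y \<in> F x. b / 2 ^ Suc j \<le> f y} \<le> card Y0"
      using finF by (intro card_mono) (auto simp: Y0_def)
    then have "J * (2 * D * card {y \<in> F x. b / 2 ^ Suc j \<le> f y}) \<le> J * (2 * D * card Y0)"
      using D by (intro mult_left_mono) auto
    moreover have "b / 2 ^ j = 2 * D" by (simp add: D_def)
    ultimately have "g / 2 \<le> J * (2 * D * card Y0)" using j(2) by (simp only:)
    then show ?thesis using pos by (simp add: field_simps)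
  qed
  \<comment> \<open>At most \<open>D * card Y0 / 4\<close> bad pairs start in \<open>Y0\<close>, so
    by Markov at most half of \<open>Y0\<close> is removed.\<close>
  define Z where "Z = {y \<in> Y0. D / 2 < bdeg y}"
  define Y where "Y = Y0 - Z"
  have finY0: "finite Y0" using finF by (simp add: Y0_def)
  have "card Z * (D / 2) \<le> (\<Sum>y\<in>Y0. bdeg y)"
    unfolding Z_def by (rule markov_card[OF finY0]) (auto simp: bdeg_def intro: sum_nonneg)
  also have "\<dots> \<le> (\<Sum>y\<in>F x. bdeg y)"
    using finF by (intro sum_mono2) (auto simp: Y0_def bdeg_def intro: sum_nonneg)
  also have "\<dots> = bad x" by (simp add: bad_def bdeg_def)
  also have "\<dots> \<le> g / (16 * J)" using g_bad pos by (simp add: field_simps)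
  also have "\<dots> \<le> D * card Y0 / 4" using Y0 by simp
  finally have "card Z \<le> card Y0 / 2" using D by (simp add: field_simps)
  moreover have "real (card Y) = real (card Y0) - card Z"
    unfolding Y_def using finY0 card_mono[OF finY0, of Z]
    by (subst card_Diff_subset) (auto simp: Z_def of_nat_diff)
  ultimately have "card Y0 \<le> 2 * real (card Y)" by linarith
  then have "D * card Y0 \<le> D * (2 * card Y)" using D by (intro mult_left_mono) auto
  then have Y: "g / (8 * J) \<le> D * card Y"
  proof -
    have "g / (8 * J) = g / (4 * J) / 2" by simp
    then show ?thesis using Y0 \<open>D * card Y0 \<le> D * (2 * card Y)\<close> by linarith
  qed
  have YA: "Y \<subseteq> A" by (auto simp: Y_def Y0_def F_def)
  have Yc: "finite Y" "Y \<subseteq> carrier G" using YA A finite_subset by auto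
  have Fc: "F x \<subseteq> carrier G" using A by (auto simp: F_def)
  \<comment> \<open>At least \<open>D\<close> points are good for \<open>y\<close> and at most
    \<open>D / 2\<close> are bad for \<open>z\<close>, so at least \<open>D / 2\<close> points join
    the two.\<close>
  have "card (quots Y Y) * (D / 2 * (\<theta> * \<theta>')) \<le> card A ^ 4"
  proof (rule card_quots_paths[OF A finF Fc Yc])
    fix y z assume y: "y \<in> Y" and z: "z \<in> Y"
    let ?W = "{w \<in> F x. \<theta> \<le> rep A A (y \<oslash> w) \<and> \<theta>' \<le> rep A A (z \<oslash> w)}"
    have "D \<le> card {w \<in> F x. \<theta> \<le> rep A A (y \<oslash> w)}"
      using y by (auto simp: Y_def Y0_def deg_def sum_of_bool_eq_card[OF finF])
    moreover have "card {w \<in> F x. rep A A (z \<oslash> w) < \<theta>'} \<le> D / 2"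
      using z by (auto simp: Y_def Z_def bdeg_def sum_of_bool_eq_card[OF finF])
    moreover have "card {w \<in> F x. \<theta> \<le> rep A A (y \<oslash> w)}
        \<le> card (?W \<union> {w \<in> F x. rep A A (z \<oslash> w) < \<theta>'})"
      using finF by (intro card_mono) auto
    moreover have "\<dots> \<le> card ?W + card {w \<in> F x. rep A A (z \<oslash> w) < \<theta>'}"
      by (rule card_Un_le)
    ultimately show "D / 2 \<le> card ?W" by linarith
  qed (use pos \<theta>' in auto)
  then have "card (quots Y Y) * (D / 2 * (\<theta> * \<theta>')) \<le> n ^ 4" by (simp add: n_def)
  then have paths: "card (quots Y Y) * (D * \<theta> * V) \<le> 128 * J * p ^ 2 * n ^ 4"
    using p pos by (simp add: \<theta>'_def field_simps)
  have "V \<le> 32 * J * n * p * card Y"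
  proof -
    have "V / (4 * n * p) * b \<le> 8 * J * (D * card Y)"
      using Y g_b pos by (simp add: field_simps)
    also have "\<dots> \<le> 8 * J * (b * card Y)"
      using D_b by (intro mult_left_mono mult_right_mono) auto
    also have "\<dots> = 8 * J * card Y * b" by simp
    finally have "V / (4 * n * p) \<le> 8 * J * card Y"
      using b by (rule mult_right_le_imp_le)
    then show ?thesis using n p by (simp add: field_simps)
  qed
  moreover have "card (quots Y Y) * (V ^ 3 * \<theta>)
               \<le> 16384 * real J ^ 2 * n ^ 6 * p ^ 4 * card Y"
  \<comment> \<open>The lower bound for the fibre size \<open>b\<close> supplies a second factor
    \<open>V / (4 * n * p)\<close>. The \<open>D\<close> on the right then matches the one in
    \<open>paths\<close>.\<close>
  proof -
    have "(V / (4 * n * p)) ^ 2 \<le> V / (4 * n * p) * b"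
      unfolding power2_eq_square using b_V pos n p by (intro mult_left_mono) auto
    also have "\<dots> \<le> 8 * J * (D * card Y)"
      using Y g_b pos by (simp add: field_simps)
    finally have "V ^ 2 \<le> 128 * J * n ^ 2 * p ^ 2 * (D * card Y)"
      using n p by (simp add: field_simps power2_eq_square)
    then have "card (quots Y Y) * (\<theta> * V) * V ^ 2
        \<le> card (quots Y Y) * (\<theta> * V) * (128 * J * n ^ 2 * p ^ 2 * (D * card Y))"
      using pos by (intro mult_left_mono) auto
    also have "\<dots> = card (quots Y Y) * (D * \<theta> * V) * (128 * J * n ^ 2 * p ^ 2 * card Y)"
      by (simp add: mult_ac)
    also have "\<dots> \<le> 128 * J * p ^ 2 * n ^ 4 * (128 * J * n ^ 2 * p ^ 2 * card Y)"
      using n p pos by (intro mult_right_mono paths) auto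
    finally show ?thesis by (simp add: power2_eq_square power3_eq_cube numeral_eq_Suc mult_ac)
  qed
  ultimately show ?thesis using YA by (intro exI[of _ Y]) (auto simp: n_def p_def)
qed

end

subsection \<open>Differences of popular differences\<close>

text \<open>AM-GM for the terms \<open>t * u\<close>, \<open>\<delta> ^ 3 / t\<close> and
  \<open>\<delta> ^ 3 / u\<close>, whose product is \<open>\<delta> ^ 6\<close>. Reciprocals of
  degrees are easy to sum over edges, products are not.\<close>

lemma walk_weight_bound:
  fixes t u \<delta> :: real
  assumes "0 < t" "0 < u" "0 \<le> \<delta>"
  shows "3 * \<delta> ^ 2 \<le> t * u + \<delta> ^ 3 * (1 / t + 1 / u)"
proof -
  define q where "q = sqrt (t * u)"
  have q: "0 < q" "q ^ 2 = t * u" using assms by (auto simp: q_def)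
  have "2 * q \<le> t + u"
    using arith_geo_mean_sqrt[of t u] assms by (simp add: q_def)
  then have "2 * q / q ^ 2 \<le> (t + u) / q ^ 2" by (intro divide_right_mono) auto
  moreover have "2 * q / q ^ 2 = 2 / q" using q(1) by (simp add: power2_eq_square)
  moreover have "(t + u) / q ^ 2 = 1 / t + 1 / u"
    unfolding q(2) using assms by (simp add: field_simps)
  ultimately have "2 / q \<le> 1 / t + 1 / u" by simp
  then have "\<delta> ^ 3 * (2 / q) \<le> \<delta> ^ 3 * (1 / t + 1 / u)"
    using assms by (intro mult_left_mono) auto
  moreover have "3 * \<delta> ^ 2 \<le> q ^ 2 + \<delta> ^ 3 * (2 / q)"
  proof -
    \<comment> \<open>The cubic \<open>q ^ 3 - 3 * \<delta> ^ 2 * q + 2 * \<delta> ^ 3\<close> in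
      factored form.\<close>
    have "0 \<le> (q - \<delta>) ^ 2 * (q + 2 * \<delta>)" using q assms by simp
    then have "3 * \<delta> ^ 2 * q \<le> q ^ 3 + 2 * \<delta> ^ 3"
      by (simp add: power2_eq_square power3_eq_cube algebra_simps)
    then show ?thesis using q by (simp add: field_simps power3_eq_cube power2_eq_square)
  qed
  ultimately show ?thesis using q by simp
qed

text \<open>Sum the previous inequality over the edges of the graph \<open>R\<close>, with \<open>\<delta>\<close> the average degree: the sum
  of \<open>1 / d x\<close> over the edges \<open>(x, y)\<close> is at most the number of vertices.\<close>
lemma three_walks:
  fixes e :: real
  assumes S: "finite S" and sym: "\<And>x y. x \<in> S \<Longrightarrow> y \<in> S \<Longrightarrow> R x y \<Longrightarrow> R y x"
    and e: "e = (\<Sum>x\<in>S. \<Sum>y\<in>S. of_bool (R x y))"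
    and d: "\<And>x. x \<in> S \<Longrightarrow> d x = (\<Sum>y\<in>S. of_bool (R x y) :: real)"
  shows "e ^ 3 \<le> real (card S) ^ 2 * (\<Sum>x\<in>S. \<Sum>y\<in>S. of_bool (R x y) * (d x * d y))"
proof (cases "S = {}")
  case True
  then show ?thesis using e by simp
next
  case False
  define n where "n = real (card S)"
  have n: "n > 0" using False S by (simp add: n_def card_gt_0_iff)
  define \<delta> where "\<delta> = e / n"
  have e0: "0 \<le> e" by (auto simp: e intro!: sum_nonneg)
  have dpos: "0 < d x" if "x \<in> S" "y \<in> S" "R x y" for x y
  proof -
    have "of_bool (R x y) \<le> d x"
      unfolding d[OF that(1)] by (rule member_le_sum) (use that S in auto)
    then show ?thesis using that by simp
  qed
  have inv: "(\<Sum>x\<in>S. \<Sum>y\<in>S. of_bool (R x y) * (1 / d x)) \<le> n"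
  proof -
    have "(\<Sum>x\<in>S. \<Sum>y\<in>S. of_bool (R x y) * (1 / d x)) = (\<Sum>x\<in>S. d x * (1 / d x))"
      unfolding sum_distrib_right[symmetric] by (rule sum.cong) (simp_all only: d)
    \<comment> \<open>A vertex of degree 0 contributes 0, because division by zero gives 0.\<close>
    also have "\<dots> \<le> (\<Sum>x\<in>S. 1)" by (intro sum_mono) auto
    finally show ?thesis by (simp add: n_def)
  qed
  have "(\<Sum>x\<in>S. \<Sum>y\<in>S. of_bool (R x y) * (1 / d y)) = (\<Sum>x\<in>S. \<Sum>y\<in>S. of_bool (R x y) * (1 / d x))"
    by (subst sum.swap) (use sym in \<open>auto intro!: sum.cong simp: of_bool_def\<close>)
  with inv have inv': "(\<Sum>x\<in>S. \<Sum>y\<in>S. of_bool (R x y) * (1 / d y)) \<le> n" by simp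
  have "3 * \<delta> ^ 2 * e = (\<Sum>x\<in>S. \<Sum>y\<in>S. of_bool (R x y) * (3 * \<delta> ^ 2))"
    by (simp add: e sum_distrib_left sum_distrib_right mult_ac)
  also have "\<dots> \<le> (\<Sum>x\<in>S. \<Sum>y\<in>S. of_bool (R x y) * (d x * d y + \<delta> ^ 3 * (1 / d x + 1 / d y)))"
  proof (intro sum_mono)
    fix x y assume xy: "x \<in> S" "y \<in> S"
    show "of_bool (R x y) * (3 * \<delta> ^ 2) \<le> of_bool (R x y) * (d x * d y + \<delta> ^ 3 * (1 / d x + 1 / d y))"
    proof (cases "R x y")
      case True
      then have "0 < d x" "0 < d y" using dpos[OF xy] dpos[OF xy(2,1)] sym[OF xy] by auto
      then show ?thesis using True walk_weight_bound[of "d x" "d y" \<delta>] e0 n by (simp add: \<delta>_def)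
    qed simp
  qed
  also have "\<dots> = (\<Sum>x\<in>S. \<Sum>y\<in>S. of_bool (R x y) * (d x * d y))
      + \<delta> ^ 3 * ((\<Sum>x\<in>S. \<Sum>y\<in>S. of_bool (R x y) * (1 / d x)) + (\<Sum>x\<in>S. \<Sum>y\<in>S. of_bool (R x y) * (1 / d y)))"
    by (simp only: distrib_left sum.distrib sum_distrib_left mult.left_commute[of _ "\<delta> ^ 3"])
  also have "\<dots> \<le> (\<Sum>x\<in>S. \<Sum>y\<in>S. of_bool (R x y) * (d x * d y)) + \<delta> ^ 3 * (n + n)"
    using inv inv' e0 n by (intro add_left_mono mult_left_mono add_mono) (auto simp: \<delta>_def)
  \<comment> \<open>As \<open>e = \<delta> * n\<close>, the reciprocals consume two of the three
    copies of \<open>\<delta> ^ 2 * e\<close>.\<close>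
  also have "\<delta> ^ 3 * (n + n) = 2 * \<delta> ^ 2 * e"
    using n by (simp add: \<delta>_def power2_eq_square power3_eq_cube)
  finally have "\<delta> ^ 2 * e \<le> (\<Sum>x\<in>S. \<Sum>y\<in>S. of_bool (R x y) * (d x * d y))"
    by (simp add: mult.commute)
  then have "n ^ 2 * (\<delta> ^ 2 * e) \<le> n ^ 2 * (\<Sum>x\<in>S. \<Sum>y\<in>S. of_bool (R x y) * (d x * d y))"
    by (intro mult_left_mono) auto
  then show ?thesis using n by (simp add: \<delta>_def n_def[symmetric] power2_eq_square power3_eq_cube)
qed

lemma Cauchy_Schwarz_double_sum:
  fixes f g :: "'b \<Rightarrow> 'c \<Rightarrow> real"
  shows "(\<Sum>x\<in>S. \<Sum>y\<in>T. f x y * g x y) ^ 2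
       \<le> (\<Sum>x\<in>S. \<Sum>y\<in>T. f x y ^ 2) * (\<Sum>x\<in>S. \<Sum>y\<in>T. g x y ^ 2)"
  using Cauchy_Schwarz_ineq_sum[of "case_prod f" "case_prod g" "S \<times> T"]
  by (simp add: sum.cartesian_product case_prod_unfold)

section \<open>Pairs of popular differences: moments and counts\<close>

context comm_group
begin

text \<open>The involution \<open>y \<mapsto> x \<oslash> y\<close> turns a sum over the neighbours
  of \<open>x\<close> in the graph into a sum over \<open>P\<close>.\<close>

lemma sum_quot_swap:
  fixes F :: "'a \<Rightarrow> real"
  assumes "finite A" "A \<subseteq> carrier G" "finite P" "P \<subseteq> carrier G" "x \<in> carrier G"
  shows "(\<Sum>y\<in>A. of_bool (x \<oslash> y \<in> P) * F y) = (\<Sum>\<alpha>\<in>P. of_bool (x \<oslash> \<alpha> \<in> A) * F (x \<oslash> \<alpha>))"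
proof -
  have filter: "(\<Sum>y\<in>S. of_bool (R y) * H y) = (\<Sum>y\<in>{y \<in> S. R y}. H y)"
    if "finite S" for S R and H :: "'a \<Rightarrow> real"
    using that by (simp add: sum.inter_filter of_bool_def if_distrib[of "\<lambda>u. u * _"] cong: if_cong)
  have "(\<Sum>y\<in>A. of_bool (x \<oslash> y \<in> P) * F y) = (\<Sum>y\<in>{y \<in> A. x \<oslash> y \<in> P}. F y)"
    using assms by (intro filter) auto
  also have "\<dots> = (\<Sum>\<alpha>\<in>{\<alpha> \<in> P. x \<oslash> \<alpha> \<in> A}. F (x \<oslash> \<alpha>))"
    using assms
    by (intro sum.reindex_bij_witness[where i = "\<lambda>\<alpha>. x \<oslash> \<alpha>" and j = "\<lambda>y. x \<oslash> y"])
      (auto simp: subset_iff)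
  also have "\<dots> = (\<Sum>\<alpha>\<in>P. of_bool (x \<oslash> \<alpha> \<in> A) * F (x \<oslash> \<alpha>))"
    using assms by (intro filter[symmetric]) auto
  finally show ?thesis .
qed

lemma third_moment_eq:
  assumes "finite A" "A \<subseteq> carrier G"
  shows "(\<Sum>x\<in>quots A A. rep A A x ^ 3) = (\<Sum>a\<in>A. \<Sum>b\<in>A. rep A A (a \<oslash> b) ^ 2)"
  using sum_rep[OF assms assms, of "\<lambda>x. rep A A x ^ 2"]
  by (simp add: power2_eq_square power3_eq_cube mult_ac)

text \<open>For the 0-1 matrix with entries \<open>i x \<alpha>\<close>, both products with its
  transpose have the same sum of squared entries. In one order this is the left side; in the other
  order the entries are at most \<open>rep A A (x \<oslash> y)\<close>.\<close>

lemma common_translates_le: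
  assumes A: "finite A" "A \<subseteq> carrier G" and P: "finite P" "P \<subseteq> carrier G"
  shows "(\<Sum>\<alpha>\<in>P. \<Sum>\<beta>\<in>P. (\<Sum>x\<in>A. of_bool (x \<oslash> \<alpha> \<in> A) * of_bool (x \<oslash> \<beta> \<in> A)) ^ 2)
       \<le> (\<Sum>x\<in>quots A A. rep A A x ^ 3)" (is "?l \<le> ?r")
proof -
  define i where "i x \<alpha> = (of_bool (x \<oslash> \<alpha> \<in> A) :: real)" for x \<alpha>
  have "?l = (\<Sum>\<alpha>\<in>P. \<Sum>\<beta>\<in>P. \<Sum>x\<in>A. \<Sum>y\<in>A. (i x \<alpha> * i y \<alpha>) * (i x \<beta> * i y \<beta>))"
    unfolding power2_eq_square sum_product i_def by (intro sum.cong refl) (simp add: mult_ac)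
  also have "\<dots> = (\<Sum>\<alpha>\<in>P. \<Sum>x\<in>A. \<Sum>\<beta>\<in>P. \<Sum>y\<in>A. (i x \<alpha> * i y \<alpha>) * (i x \<beta> * i y \<beta>))"
    by (rule sum.cong[OF refl], rule sum.swap)
  also have "\<dots> = (\<Sum>x\<in>A. \<Sum>\<alpha>\<in>P. \<Sum>y\<in>A. \<Sum>\<beta>\<in>P. (i x \<alpha> * i y \<alpha>) * (i x \<beta> * i y \<beta>))"
    by (subst sum.swap, rule sum.cong[OF refl], rule sum.cong[OF refl], rule sum.swap)
  also have "\<dots> = (\<Sum>x\<in>A. \<Sum>y\<in>A. \<Sum>\<alpha>\<in>P. \<Sum>\<beta>\<in>P. (i x \<alpha> * i y \<alpha>) * (i x \<beta> * i y \<beta>))"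
    by (rule sum.cong[OF refl], rule sum.swap)
  also have "\<dots> = (\<Sum>x\<in>A. \<Sum>y\<in>A. (\<Sum>\<alpha>\<in>P. i x \<alpha> * i y \<alpha>) ^ 2)"
    by (simp only: power2_eq_square sum_product)
  also have "\<dots> \<le> (\<Sum>x\<in>A. \<Sum>y\<in>A. rep A A (x \<oslash> y) ^ 2)"
  proof (intro sum_mono power_mono)
    fix x y assume xy: "x \<in> A" "y \<in> A"
    have "(\<Sum>\<alpha>\<in>P. i x \<alpha> * i y \<alpha>) = (\<Sum>\<alpha>\<in>P. of_bool (x \<oslash> \<alpha> \<in> A \<and> y \<oslash> \<alpha> \<in> A))"
      by (intro sum.cong refl) (simp add: i_def)
    also have "\<dots> = card {\<alpha> \<in> P. x \<oslash> \<alpha> \<in> A \<and> y \<oslash> \<alpha> \<in> A}"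
      by (rule sum_of_bool_eq_card[OF P(1)])
    also have "\<dots> \<le> card {\<alpha> \<in> quots A A. x \<oslash> \<alpha> \<in> A \<and> y \<oslash> \<alpha> \<in> A}"
    proof (intro of_nat_mono card_mono subsetI)
      fix \<alpha> assume \<alpha>: "\<alpha> \<in> {\<alpha> \<in> P. x \<oslash> \<alpha> \<in> A \<and> y \<oslash> \<alpha> \<in> A}"
      then have "x \<oslash> (x \<oslash> \<alpha>) \<in> quots A A" using xy by (intro quotsI) auto
      moreover have "x \<oslash> (x \<oslash> \<alpha>) = \<alpha>" using \<alpha> xy A P by (auto simp: subset_iff)
      ultimately show "\<alpha> \<in> {\<alpha> \<in> quots A A. x \<oslash> \<alpha> \<in> A \<and> y \<oslash> \<alpha> \<in> A}" using \<alpha> by auto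
    qed (use A in auto)
    also have "\<dots> = rep A A (x \<oslash> y)" using rep_card_common[OF A xy A(2)] by simp
    finally show "(\<Sum>\<alpha>\<in>P. i x \<alpha> * i y \<alpha>) \<le> rep A A (x \<oslash> y)" .
  qed (auto simp: i_def intro!: sum_nonneg)
  finally show ?thesis unfolding third_moment_eq[OF A] .
qed

text \<open>A quantitative form of \<open>tr (T R T) \<ge> \<langle>1, T R T 1\<rangle> / n\<close>, where \<open>T\<close> is the adjacency matrix on
  \<open>A\<close> of the relation \<open>x \<oslash> y \<in> P\<close> and \<open>R\<close> is the positive semidefinite matrix of the
  representation counts, which dominates \<open>\<tau> T\<close>.\<close>
lemma popular_differences_second_moment:
  fixes \<tau> s :: real
  assumes A: "finite A" "A \<subseteq> carrier G" and P: "finite P" "P \<subseteq> carrier G"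
    and \<tau>: "0 \<le> \<tau>" "\<And>d. d \<in> P \<Longrightarrow> \<tau> \<le> rep A A d"
    and sym: "\<And>d. d \<in> P \<Longrightarrow> inv d \<in> P"
    and s: "s = (\<Sum>x\<in>A. \<Sum>y\<in>A. of_bool (x \<oslash> y \<in> P))"
  shows "\<tau> ^ 2 * s ^ 6 \<le> real (card A) ^ 6 * (\<Sum>x\<in>quots A A. rep A A x ^ 3)
           * (\<Sum>\<alpha>\<in>P. \<Sum>\<beta>\<in>P. rep A A (\<alpha> \<oslash> \<beta>) ^ 2)"
proof (cases "A = {}")
  case True
  then show ?thesis using s by simp
next
  case False
  define n where "n = real (card A)"
  have n: "n > 0" using False A by (simp add: n_def card_gt_0_iff)
  define t where "t x y = (of_bool (x \<oslash> y \<in> P) :: real)" for x y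
  define d where "d x = (\<Sum>y\<in>A. t x y)" for x
  have t_sym: "t x y = t y x" if "x \<in> A" "y \<in> A" for x y
  proof -
    have "x \<in> carrier G" "y \<in> carrier G" using that A by auto
    then have "x \<oslash> y \<in> P \<longleftrightarrow> y \<oslash> x \<in> P"
      using sym[of "x \<oslash> y"] sym[of "y \<oslash> x"] by (auto simp: inv_quot)
    then show ?thesis by (simp add: t_def)
  qed
  define g where "g x u = (\<Sum>y\<in>{a \<in> A. a \<oslash> u \<in> A}. t x y)" for x u
  \<comment> \<open>\<open>T3\<close> is the trace of \<open>T R T\<close>, and \<open>W\<close>
    counts walks of length three by their middle edge.\<close>
  define T3 where "T3 = (\<Sum>x\<in>A. \<Sum>y\<in>A. \<Sum>z\<in>A. t x y * t x z * rep A A (y \<oslash> z))"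
  define W where "W = (\<Sum>x\<in>A. \<Sum>y\<in>A. t x y * (d x * d y))"
  have walks: "s ^ 3 \<le> n ^ 2 * W"
    unfolding n_def W_def t_def
  proof (rule three_walks[where R = "\<lambda>x y. x \<oslash> y \<in> P" and d = d, OF A(1) _ s])
    show "x \<in> A \<Longrightarrow> y \<in> A \<Longrightarrow> x \<oslash> y \<in> P \<Longrightarrow> y \<oslash> x \<in> P" for x y
      using t_sym[of x y] by (auto simp: t_def)
  qed (simp only: d_def t_def)
  have "\<tau> * W \<le> (\<Sum>y\<in>A. \<Sum>z\<in>A. d y * d z * rep A A (y \<oslash> z))"
    unfolding W_def sum_distrib_left
  proof (intro sum_mono)
    fix x y
    have "0 \<le> d x * d y" by (auto simp: d_def t_def intro!: mult_nonneg_nonneg sum_nonneg)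
    moreover have "\<tau> * t x y \<le> rep A A (x \<oslash> y)" using \<tau> by (auto simp: t_def)
    ultimately have "d x * d y * (\<tau> * t x y) \<le> d x * d y * rep A A (x \<oslash> y)"
      by (rule mult_left_mono[rotated])
    then show "\<tau> * (t x y * (d x * d y)) \<le> d x * d y * rep A A (x \<oslash> y)" by (simp add: mult_ac)
  qed
  \<comment> \<open>Here positive semidefiniteness enters: \<open>R\<close> is a Gram matrix, so its
    quadratic form is a sum of squares over \<open>u\<close>.\<close>
  also have "\<dots> = (\<Sum>u\<in>quots A A. \<Sum>y\<in>{a \<in> A. a \<oslash> u \<in> A}. \<Sum>z\<in>{a \<in> A. a \<oslash> u \<in> A}. d y * d z)"
    by (rule sum_pairs_fibres[OF A A, symmetric])
  also have "\<dots> = (\<Sum>u\<in>quots A A. (\<Sum>y\<in>{a \<in> A. a \<oslash> u \<in> A}. d y) ^ 2)"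
    by (simp add: power2_eq_square sum_product)
  also have "\<dots> = (\<Sum>u\<in>quots A A. (\<Sum>x\<in>A. g x u) ^ 2)"
  proof (rule sum.cong[OF refl])
    fix u
    have "(\<Sum>y\<in>{a \<in> A. a \<oslash> u \<in> A}. d y) = (\<Sum>y\<in>{a \<in> A. a \<oslash> u \<in> A}. \<Sum>x\<in>A. t x y)"
      unfolding d_def by (intro sum.cong refl t_sym) auto
    also have "\<dots> = (\<Sum>x\<in>A. g x u)" unfolding g_def by (rule sum.swap)
    finally show "(\<Sum>y\<in>{a \<in> A. a \<oslash> u \<in> A}. d y) ^ 2 = (\<Sum>x\<in>A. g x u) ^ 2" by simp
  qed
  \<comment> \<open>Cauchy--Schwarz over \<open>x\<close> leads from the sum of all entries of
    \<open>T R T\<close> to \<open>n\<close> times the trace.\<close>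
  also have "\<dots> \<le> (\<Sum>u\<in>quots A A. n * (\<Sum>x\<in>A. g x u ^ 2))"
    unfolding n_def using sum_squared_le_sum_of_squares[of "\<lambda>x. g x _" A]
    by (intro sum_mono) (simp add: mult.commute)
  also have "\<dots> = n * (\<Sum>x\<in>A. \<Sum>u\<in>quots A A. g x u ^ 2)"
    unfolding sum_distrib_left by (rule sum.swap)
  also have "(\<Sum>x\<in>A. \<Sum>u\<in>quots A A. g x u ^ 2) = T3"
    unfolding g_def power2_eq_square sum_product T3_def
    by (intro sum.cong refl sum_pairs_fibres[OF A A])
  finally have W_T3: "\<tau> * W \<le> n * T3" .
  \<comment> \<open>With the neighbours of \<open>x\<close> written as
    \<open>x \<oslash> \<alpha>\<close> and \<open>x \<oslash> \<beta>\<close>, the trace becomes a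
    correlation of \<open>C\<close> with the representation counts, which Cauchy--Schwarz
    separates.\<close>
  define C where "C \<alpha> \<beta> = (\<Sum>x\<in>A. of_bool (x \<oslash> \<alpha> \<in> A) * of_bool (x \<oslash> \<beta> \<in> A) :: real)" for \<alpha> \<beta>
  have "T3 = (\<Sum>x\<in>A. \<Sum>\<alpha>\<in>P. \<Sum>\<beta>\<in>P. of_bool (x \<oslash> \<alpha> \<in> A) * of_bool (x \<oslash> \<beta> \<in> A) * rep A A (\<alpha> \<oslash> \<beta>))"
    unfolding T3_def
  proof (rule sum.cong[OF refl])
    fix x assume "x \<in> A"
    then have x: "x \<in> carrier G" using A by auto
    have "(\<Sum>y\<in>A. \<Sum>z\<in>A. t x y * t x z * rep A A (y \<oslash> z))
        = (\<Sum>y\<in>A. of_bool (x \<oslash> y \<in> P) * (\<Sum>z\<in>A. of_bool (x \<oslash> z \<in> P) * rep A A (y \<oslash> z)))"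
      by (simp add: t_def sum_distrib_left mult_ac)
    also have "\<dots> = (\<Sum>\<alpha>\<in>P. of_bool (x \<oslash> \<alpha> \<in> A)
        * (\<Sum>z\<in>A. of_bool (x \<oslash> z \<in> P) * rep A A ((x \<oslash> \<alpha>) \<oslash> z)))"
      by (rule sum_quot_swap[OF A P x])
    also have "\<dots> = (\<Sum>\<alpha>\<in>P. of_bool (x \<oslash> \<alpha> \<in> A)
        * (\<Sum>\<beta>\<in>P. of_bool (x \<oslash> \<beta> \<in> A) * rep A A ((x \<oslash> \<alpha>) \<oslash> (x \<oslash> \<beta>))))"
      by (simp only: sum_quot_swap[OF A P x])
    also have "\<dots> = (\<Sum>\<alpha>\<in>P. \<Sum>\<beta>\<in>P. of_bool (x \<oslash> \<alpha> \<in> A) * of_bool (x \<oslash> \<beta> \<in> A) * rep A A (\<alpha> \<oslash> \<beta>))"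
      unfolding sum_distrib_left
    proof (intro sum.cong refl)
      fix \<alpha> \<beta> assume "\<alpha> \<in> P" "\<beta> \<in> P"
      then have c: "\<alpha> \<in> carrier G" "\<beta> \<in> carrier G" using P by auto
      then have "rep A A ((x \<oslash> \<alpha>) \<oslash> (x \<oslash> \<beta>)) = rep A A (\<alpha> \<oslash> \<beta>)"
        using x rep_quot_commute[OF A c] by simp
      then show "of_bool (x \<oslash> \<alpha> \<in> A) * (of_bool (x \<oslash> \<beta> \<in> A) * rep A A ((x \<oslash> \<alpha>) \<oslash> (x \<oslash> \<beta>)))
          = of_bool (x \<oslash> \<alpha> \<in> A) * of_bool (x \<oslash> \<beta> \<in> A) * rep A A (\<alpha> \<oslash> \<beta>)"
        by simp
    qed
    finally show "(\<Sum>y\<in>A. \<Sum>z\<in>A. t x y * t x z * rep A A (y \<oslash> z))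
        = (\<Sum>\<alpha>\<in>P. \<Sum>\<beta>\<in>P. of_bool (x \<oslash> \<alpha> \<in> A) * of_bool (x \<oslash> \<beta> \<in> A) * rep A A (\<alpha> \<oslash> \<beta>))" .
  qed
  also have "\<dots> = (\<Sum>\<alpha>\<in>P. \<Sum>\<beta>\<in>P. C \<alpha> \<beta> * rep A A (\<alpha> \<oslash> \<beta>))"
    unfolding C_def sum_distrib_right
    by (subst sum.swap, rule sum.cong[OF refl], rule sum.swap)
  finally have "T3 ^ 2 \<le> (\<Sum>\<alpha>\<in>P. \<Sum>\<beta>\<in>P. C \<alpha> \<beta> ^ 2) * (\<Sum>\<alpha>\<in>P. \<Sum>\<beta>\<in>P. rep A A (\<alpha> \<oslash> \<beta>) ^ 2)"
    by (simp only: Cauchy_Schwarz_double_sum)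
  also have "\<dots> \<le> (\<Sum>x\<in>quots A A. rep A A x ^ 3) * (\<Sum>\<alpha>\<in>P. \<Sum>\<beta>\<in>P. rep A A (\<alpha> \<oslash> \<beta>) ^ 2)"
    unfolding C_def by (intro mult_right_mono common_translates_le[OF A P] sum_nonneg) auto
  finally have T3: "T3 ^ 2 \<le> (\<Sum>x\<in>quots A A. rep A A x ^ 3) * (\<Sum>\<alpha>\<in>P. \<Sum>\<beta>\<in>P. rep A A (\<alpha> \<oslash> \<beta>) ^ 2)" .
  have s0: "0 \<le> s" by (auto simp: s intro!: sum_nonneg)
  have "\<tau> * s ^ 3 \<le> n ^ 3 * T3"
  proof -
    have "\<tau> * s ^ 3 \<le> \<tau> * (n ^ 2 * W)" using walks \<tau> by (intro mult_left_mono) auto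
    also have "\<dots> = n ^ 2 * (\<tau> * W)" by simp
    also have "\<dots> \<le> n ^ 2 * (n * T3)" using W_T3 by (intro mult_left_mono) auto
    finally show ?thesis by (simp add: power2_eq_square power3_eq_cube)
  qed
  then have "(\<tau> * s ^ 3) ^ 2 \<le> (n ^ 3 * T3) ^ 2" using \<tau> s0 by (intro power_mono) auto
  also have "\<dots> = n ^ 6 * T3 ^ 2" by (simp add: power_mult_distrib flip: power_mult)
  also have "\<dots> \<le> n ^ 6 * ((\<Sum>x\<in>quots A A. rep A A x ^ 3) * (\<Sum>\<alpha>\<in>P. \<Sum>\<beta>\<in>P. rep A A (\<alpha> \<oslash> \<beta>) ^ 2))"
    using T3 by (intro mult_left_mono) auto
  finally show ?thesis
    by (simp add: n_def power_mult_distrib mult_ac flip: power_mult)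
qed

text \<open>Replace \<open>\<alpha>\<close> by its representations \<open>a \<oslash> b\<close>, at
  least \<open>\<tau>\<close> in number. As \<open>D\<close> is closed under inverses, the condition
  becomes \<open>b \<oslash> (a \<oslash> \<beta>) \<in> D\<close>, and summing over
  \<open>b\<close> leaves a correlation of \<open>rep A P\<close> with \<open>rep A D\<close> for
  Cauchy--Schwarz.\<close>

lemma count_popular_quots_le:
  fixes \<tau> :: real
  assumes A: "finite A" "A \<subseteq> carrier G" and P: "finite P" "P \<subseteq> carrier G"
    and D: "finite D" "D \<subseteq> carrier G"
    and \<tau>: "0 \<le> \<tau>" "\<And>d. d \<in> P \<Longrightarrow> \<tau> \<le> rep A A d"
    and sym: "\<And>d. d \<in> D \<Longrightarrow> inv d \<in> D"
  shows "(\<tau> * (\<Sum>\<alpha>\<in>P. \<Sum>\<beta>\<in>P. of_bool (\<alpha> \<oslash> \<beta> \<in> D))) ^ 2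
       \<le> (\<Sum>x\<in>quots A P. rep A P x ^ 2) * (\<Sum>x\<in>quots A D. rep A D x ^ 2)"
proof -
  let ?S = "\<Sum>\<alpha>\<in>P. \<Sum>\<beta>\<in>P. of_bool (\<alpha> \<oslash> \<beta> \<in> D) :: real"
  have "\<tau> * ?S \<le> (\<Sum>\<alpha>\<in>P. \<Sum>\<beta>\<in>P. rep A A \<alpha> * of_bool (\<alpha> \<oslash> \<beta> \<in> D))"
    unfolding sum_distrib_left using \<tau> by (intro sum_mono mult_right_mono) auto
  also have "\<dots> \<le> (\<Sum>\<alpha>\<in>quots A A. \<Sum>\<beta>\<in>P. rep A A \<alpha> * of_bool (\<alpha> \<oslash> \<beta> \<in> D))"
  proof -
    have "(\<Sum>\<alpha>\<in>P. \<Sum>\<beta>\<in>P. rep A A \<alpha> * of_bool (\<alpha> \<oslash> \<beta> \<in> D))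
        = (\<Sum>\<alpha>\<in>P \<inter> quots A A. \<Sum>\<beta>\<in>P. rep A A \<alpha> * of_bool (\<alpha> \<oslash> \<beta> \<in> D))"
      using P rep_eq_0[OF A(2) A(2)] by (intro sum.mono_neutral_right) auto
    also have "\<dots> \<le> (\<Sum>\<alpha>\<in>quots A A. \<Sum>\<beta>\<in>P. rep A A \<alpha> * of_bool (\<alpha> \<oslash> \<beta> \<in> D))"
      using A by (intro sum_mono2) (auto intro!: sum_nonneg)
    finally show ?thesis .
  qed
  also have "\<dots> = (\<Sum>a\<in>A. \<Sum>b\<in>A. \<Sum>\<beta>\<in>P. of_bool ((a \<oslash> b) \<oslash> \<beta> \<in> D))"
    unfolding sum_distrib_left[symmetric]
    by (rule sum_rep[OF A A, symmetric])
  also have "\<dots> = (\<Sum>a\<in>A. \<Sum>\<beta>\<in>P. \<Sum>b\<in>A. of_bool ((a \<oslash> b) \<oslash> \<beta> \<in> D))"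
    by (rule sum.cong[OF refl], rule sum.swap)
  also have "\<dots> = (\<Sum>a\<in>A. \<Sum>\<beta>\<in>P. rep A D (a \<oslash> \<beta>))"
  proof (intro sum.cong refl)
    fix a \<beta> assume "a \<in> A" "\<beta> \<in> P"
    then have c: "a \<in> carrier G" "\<beta> \<in> carrier G" using A P by auto
    have "(a \<oslash> b) \<oslash> \<beta> \<in> D \<longleftrightarrow> b \<oslash> (a \<oslash> \<beta>) \<in> D" if "b \<in> A" for b
    proof -
      have b: "b \<in> carrier G" using that A by auto
      have "(a \<oslash> b) \<oslash> \<beta> = inv (b \<oslash> (a \<oslash> \<beta>))" using b c by (simp add: inv_quot quot_swap)
      then show ?thesis using sym[of "(a \<oslash> b) \<oslash> \<beta>"] sym[of "b \<oslash> (a \<oslash> \<beta>)"] b c by auto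
    qed
    then have "(\<Sum>b\<in>A. of_bool ((a \<oslash> b) \<oslash> \<beta> \<in> D)) = (\<Sum>b\<in>A. of_bool (b \<oslash> (a \<oslash> \<beta>) \<in> D) :: real)"
      by (intro sum.cong) auto
    then show "(\<Sum>b\<in>A. of_bool ((a \<oslash> b) \<oslash> \<beta> \<in> D)) = rep A D (a \<oslash> \<beta>)"
      by (simp only: rep_def sum_of_bool_eq_card[OF A(1)])
  qed
  also have "\<dots> = (\<Sum>x\<in>quots A P. rep A P x * rep A D x)"
    by (rule sum_rep[OF A P])
  finally have le: "\<tau> * ?S \<le> (\<Sum>x\<in>quots A P. rep A P x * rep A D x)" .
  have "0 \<le> \<tau> * ?S" using \<tau> by (auto intro!: mult_nonneg_nonneg sum_nonneg)
  then have "(\<tau> * ?S) ^ 2 \<le> (\<Sum>x\<in>quots A P. rep A P x * rep A D x) ^ 2"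
    using le by (intro power_mono) auto
  also have "\<dots> \<le> (\<Sum>x\<in>quots A P. rep A P x ^ 2) * (\<Sum>x\<in>quots A P. rep A D x ^ 2)"
    by (rule Cauchy_Schwarz_ineq_sum)
  also have "\<dots> \<le> (\<Sum>x\<in>quots A P. rep A P x ^ 2) * (\<Sum>x\<in>quots A D. rep A D x ^ 2)"
  proof (intro mult_left_mono sum_nonneg)
    have "(\<Sum>x\<in>quots A P. rep A D x ^ 2) = (\<Sum>x\<in>quots A P \<inter> quots A D. rep A D x ^ 2)"
      using rep_eq_0[OF A(2) D(2)] quots_subset[OF A(2) P(2)] A P
      by (intro sum.mono_neutral_right) auto
    also have "\<dots> \<le> (\<Sum>x\<in>quots A D. rep A D x ^ 2)"
      using A D by (intro sum_mono2) auto
    finally show "(\<Sum>x\<in>quots A P. rep A D x ^ 2) \<le> (\<Sum>x\<in>quots A D. rep A D x ^ 2)" .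
  qed auto
  finally show ?thesis .
qed

text \<open>Cauchy--Schwarz between the third moment and the first, which is
  \<open>card A * card B\<close>.\<close>

lemma second_moment_le:
  assumes A: "finite A" "A \<subseteq> carrier G" and B: "finite B" "B \<subseteq> carrier G"
  shows "(\<Sum>x\<in>quots A B. rep A B x ^ 2) ^ 2
       \<le> card A * card B * (\<Sum>x\<in>quots A B. rep A B x ^ 3)"
proof -
  have "(\<Sum>x\<in>quots A B. sqrt (rep A B x) * sqrt (rep A B x ^ 3)) ^ 2
      \<le> (\<Sum>x\<in>quots A B. sqrt (rep A B x) ^ 2) * (\<Sum>x\<in>quots A B. sqrt (rep A B x ^ 3) ^ 2)"
    by (rule Cauchy_Schwarz_ineq_sum)
  also have "\<dots> = card A * card B * (\<Sum>x\<in>quots A B. rep A B x ^ 3)"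
    using sum_rep_eq[OF A B] by simp
  also have "(\<Sum>x\<in>quots A B. sqrt (rep A B x) * sqrt (rep A B x ^ 3)) = (\<Sum>x\<in>quots A B. rep A B x ^ 2)"
  proof (intro sum.cong refl)
    fix x
    have "sqrt (rep A B x) * sqrt (rep A B x ^ 3) = sqrt ((rep A B x ^ 2) ^ 2)"
      by (simp add: real_sqrt_mult[symmetric] flip: power_Suc power_mult)
    also have "\<dots> = rep A B x ^ 2" by (simp only: real_sqrt_abs) simp
    finally show "sqrt (rep A B x) * sqrt (rep A B x ^ 3) = rep A B x ^ 2" .
  qed
  finally show ?thesis .
qed

end

subsection \<open>The dichotomy\<close>

lemma ln_leI:
  fixes x y :: real
  shows "0 < x \<Longrightarrow> x \<le> y \<Longrightarrow> ln x \<le> ln y"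
  by simp

context comm_group
begin

text \<open>The two estimates with the exact exponents; \<open>\<epsilon>\<close> comes in by
  monotonicity of \<open>powr\<close> in \<open>ex_energy_const\<close>.\<close>

definition structured :: "real \<Rightarrow> real \<Rightarrow> 'a set \<Rightarrow> bool" where
  "structured C K A \<longleftrightarrow> (\<exists>A'\<subseteq>A. K powr (- 100 / 81) * real (card A) \<le> C * real (card A')
     \<and> real (card (quots A' A')) \<le> C * (K powr (100 / 27) * real (card A')))"

text \<open>The equation \<open>a \<otimes> b = c \<otimes> d\<close> means
  \<open>d \<oslash> b = a \<oslash> c\<close>, so the quadruples are pairs of pairs with equal
  quotient.\<close>

lemma additive_energy_eq:
  assumes A: "finite A" "A \<subseteq> carrier G"
  shows "real (additive_energy G A) = (\<Sum>x\<in>quots A A. rep A A x ^ 2)"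
proof -
  let ?F = "\<lambda>x. {p \<in> A \<times> A. fst p \<oslash> snd p = x}"
  have iff: "a \<otimes> b = c \<otimes> d \<longleftrightarrow> d \<oslash> b = a \<oslash> c"
    if "a \<in> carrier G" "b \<in> carrier G" "c \<in> carrier G" "d \<in> carrier G" for a b c d
  proof -
    have "a \<otimes> b = c \<otimes> d \<longleftrightarrow> d = inv c \<otimes> (a \<otimes> b)"
      using that by (metis inv_solve_left m_closed)
    also have "inv c \<otimes> (a \<otimes> b) = (a \<oslash> c) \<otimes> b"
      using that by (simp add: quot_def m_ac)
    also have "d = (a \<oslash> c) \<otimes> b \<longleftrightarrow> d \<oslash> b = a \<oslash> c"
      using that by (metis inv_solve_right quot_closed quot_def)
    finally show ?thesis .
  qed
  have "bij_betw (\<lambda>(a, b, c, d). ((a, c), (d, b)))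
      {(a, b, c, d). a \<in> A \<and> b \<in> A \<and> c \<in> A \<and> d \<in> A \<and> a \<otimes> b = c \<otimes> d}
      (SIGMA q:A \<times> A. ?F (fst q \<oslash> snd q))"
    using A iff
    by (intro bij_betw_byWitness[where f' = "\<lambda>((a, c), (d, b)). (a, b, c, d)"])
      (auto simp: subset_iff)
  then have "additive_energy G A = card (SIGMA q:A \<times> A. ?F (fst q \<oslash> snd q))"
    unfolding additive_energy_def by (rule bij_betw_same_card)
  also have "\<dots> = (\<Sum>q\<in>A \<times> A. card (?F (fst q \<oslash> snd q)))"
    using A by (intro card_SigmaI) auto
  finally have "real (additive_energy G A) = (\<Sum>q\<in>A \<times> A. real (card (?F (fst q \<oslash> snd q))))"
    by simp
  also have "\<dots> = (\<Sum>q\<in>A \<times> A. rep A A (fst q \<oslash> snd q))"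
    using A by (intro sum.cong refl rep_eq_card[OF A A, symmetric]) (auto simp: subset_iff)
  also have "\<dots> = (\<Sum>a\<in>A. \<Sum>c\<in>A. rep A A (a \<oslash> c))"
    by (simp add: sum.cartesian_product case_prod_unfold)
  also have "\<dots> = (\<Sum>x\<in>quots A A. rep A A x ^ 2)"
    unfolding power2_eq_square by (rule sum_rep[OF A A])
  finally show ?thesis .
qed

text \<open>The contrapositive of \<open>large_third_moment_imp_structure\<close>. There
  \<open>\<kappa>\<close> enters the doubling bound squared, hence half of \<open>100 / 27\<close>;
  the size bound concerns the square of \<open>card A'\<close>, hence twice
  \<open>100 / 81\<close>.\<close>

lemma not_structured_imp_third_moment_less:
  fixes K \<kappa> :: real
  assumes A: "finite A" "A \<subseteq> carrier G" and B: "finite B" "B \<subseteq> carrier G"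
    and ne: "A \<noteq> {}" "B \<noteq> {}" and K: "0 < K" and ns: "\<not> structured 1024 K A"
    and \<kappa>: "K powr (- 50 / 27) \<le> \<kappa>" and size: "K powr (- 200 / 81) * card A \<le> \<kappa> * card B"
  shows "(\<Sum>x\<in>quots A B. rep A B x ^ 3) < \<kappa> * real (card A) ^ 2 * real (card B) ^ 2"
proof (rule ccontr)
  assume "\<not> ?thesis"
  moreover have \<kappa>0: "0 < \<kappa>" using \<kappa> K by (smt (verit) powr_gt_zero)
  ultimately obtain A' where A': "A' \<subseteq> A" "\<kappa> * card A * card B \<le> 16 * real (card A') ^ 2"
    "card (quots A' A') * \<kappa> ^ 2 \<le> 1024 * real (card A')"
    using large_third_moment_imp_structure[OF A B _ ne, of \<kappa>] by (auto simp: not_less)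
  have "(K powr (- 100 / 81) * card A) ^ 2 = (K powr (- 200 / 81) * card A) * card A"
    by (simp add: power2_eq_square powr_add[symmetric])
  also have "\<dots> \<le> \<kappa> * card B * card A" using size by (intro mult_right_mono) auto
  also have "\<dots> \<le> (4 * real (card A')) ^ 2" using A'(2) by (simp add: mult_ac)
  finally have "K powr (- 100 / 81) * card A \<le> 4 * real (card A')"
    by (rule power2_le_imp_le) simp
  moreover have "card (quots A' A') \<le> 1024 * (K powr (100 / 27) * card A')"
  proof -
    have "card (quots A' A') * (K powr (- 50 / 27)) ^ 2 \<le> card (quots A' A') * \<kappa> ^ 2"
      using \<kappa> by (intro mult_left_mono power_mono) auto
    also have "(K powr (- 50 / 27)) ^ 2 = inverse (K powr (100 / 27))"
      by (simp add: power2_eq_square powr_add[symmetric] powr_minus[symmetric])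
    finally have "card (quots A' A') * inverse (K powr (100 / 27)) \<le> 1024 * real (card A')"
      using A'(3) by linarith
    moreover have "0 < K powr (100 / 27)" using K by simp
    ultimately show ?thesis by (simp add: field_simps)
  qed
  ultimately have "structured 1024 K A"
    using A'(1) unfolding structured_def by (intro exI[of _ A']) auto
  then show False using ns by simp
qed

lemma not_structured_imp_second_moment_le:
  fixes K \<kappa> :: real
  assumes A: "finite A" "A \<subseteq> carrier G" and B: "finite B" "B \<subseteq> carrier G"
    and ne: "A \<noteq> {}" "B \<noteq> {}" and K: "0 < K" and ns: "\<not> structured 1024 K A"
    and \<kappa>: "K powr (- 50 / 27) \<le> \<kappa>" and size: "K powr (- 200 / 81) * card A \<le> \<kappa> * card B"
  shows "(\<Sum>x\<in>quots A B. rep A B x ^ 2) ^ 2 \<le> \<kappa> * real (card A) ^ 3 * real (card B) ^ 3"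
proof -
  have "(\<Sum>x\<in>quots A B. rep A B x ^ 2) ^ 2
      \<le> card A * card B * (\<Sum>x\<in>quots A B. rep A B x ^ 3)"
    by (rule second_moment_le[OF A B])
  also have "\<dots> \<le> card A * card B * (\<kappa> * real (card A) ^ 2 * real (card B) ^ 2)"
    using not_structured_imp_third_moment_less[OF assms] by (intro mult_left_mono) auto
  finally show ?thesis by (simp add: power2_eq_square power3_eq_cube mult_ac)
qed

text \<open>Two ways to count the mixed energy of \<open>A\<close> and \<open>P\<close>.\<close>

lemma sum_rep_quots_eq_second_moment:
  assumes A: "finite A" "A \<subseteq> carrier G" and P: "finite P" "P \<subseteq> carrier G"
  shows "(\<Sum>\<alpha>\<in>P. \<Sum>\<beta>\<in>P. rep A A (\<alpha> \<oslash> \<beta>)) = (\<Sum>x\<in>quots A P. rep A P x ^ 2)"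
proof -
  have "(\<Sum>\<alpha>\<in>P. \<Sum>\<beta>\<in>P. rep A A (\<alpha> \<oslash> \<beta>)) = (\<Sum>a\<in>A. \<Sum>b\<in>A. rep P P (a \<oslash> b))"
    using sum_rep_swap[OF P A, of "\<lambda>_. 1"] by simp
  also have "\<dots> = (\<Sum>x\<in>quots A P. rep A P x ^ 2)"
    using sum_pairs_fibres[OF A P, of "\<lambda>_ _. 1"] by (simp add: rep_def power2_eq_square)
  finally show ?thesis .
qed

lemma count_quots_in_le:
  assumes P: "finite P" "P \<subseteq> carrier G" and D: "finite D"
  shows "(\<Sum>\<alpha>\<in>P. \<Sum>\<beta>\<in>P. of_bool (\<alpha> \<oslash> \<beta> \<in> D)) \<le> real (card P) * card D"
proof -
  have "(\<Sum>\<beta>\<in>P. of_bool (\<alpha> \<oslash> \<beta> \<in> D)) \<le> real (card D)" if "\<alpha> \<in> P" for \<alpha>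
  proof -
    have "inj_on (\<lambda>\<beta>. \<alpha> \<oslash> \<beta>) {\<beta> \<in> P. \<alpha> \<oslash> \<beta> \<in> D}"
      by (rule inj_on_inverseI[where g = "\<lambda>x. \<alpha> \<oslash> x"]) (use that P in \<open>auto simp: subset_iff\<close>)
    then have "card {\<beta> \<in> P. \<alpha> \<oslash> \<beta> \<in> D} \<le> card D"
      by (rule card_inj_on_le) (use D in auto)
    then show ?thesis by (simp only: sum_of_bool_eq_card[OF P(1)] of_nat_le_iff)
  qed
  then have "(\<Sum>\<alpha>\<in>P. \<Sum>\<beta>\<in>P. of_bool (\<alpha> \<oslash> \<beta> \<in> D)) \<le> (\<Sum>\<alpha>\<in>P. real (card D))"
    by (rule sum_mono)
  then show ?thesis by simp
qed

text \<open>Restricting to \<open>quots A A\<close> keeps the set finite for every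
  \<open>\<tau>\<close>, also for \<open>\<tau> \<le> 0\<close>.\<close>

definition popular :: "'a set \<Rightarrow> real \<Rightarrow> 'a set" where
  "popular A \<tau> = {d \<in> quots A A. \<tau> \<le> rep A A d}"

lemma finite_popular [simp]: "finite A \<Longrightarrow> finite (popular A \<tau>)"
  by (simp add: popular_def)

lemma popular_subset: "A \<subseteq> carrier G \<Longrightarrow> popular A \<tau> \<subseteq> carrier G"
  using quots_subset[of A A] by (auto simp: popular_def)

lemma inv_popular:
  assumes A: "finite A" "A \<subseteq> carrier G" and "d \<in> popular A \<tau>"
  shows "inv d \<in> popular A \<tau>"
proof -
  have "d \<in> quots A A" using assms(3) by (simp add: popular_def)
  then obtain a b where d: "a \<in> A" "b \<in> A" "d = a \<oslash> b" by (rule quotsE)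
  then have c: "a \<in> carrier G" "b \<in> carrier G" using A by auto
  show ?thesis
    using d c rep_quot_commute[OF A c] assms(3) by (simp add: popular_def inv_quot quotsI)
qed

lemma popular_moment_le:
  fixes \<tau> :: real
  assumes A: "finite A" "A \<subseteq> carrier G" and "0 \<le> \<tau>"
  shows "\<tau> ^ k * (\<Sum>d\<in>popular A \<tau>. rep A A d ^ l) \<le> (\<Sum>d\<in>quots A A. rep A A d ^ (k + l))"
proof -
  have "\<tau> ^ k * (\<Sum>d\<in>popular A \<tau>. rep A A d ^ l) \<le> (\<Sum>d\<in>popular A \<tau>. rep A A d ^ (k + l))"
    unfolding sum_distrib_left power_add
    using assms by (intro sum_mono mult_right_mono power_mono) (auto simp: popular_def)
  also have "\<dots> \<le> (\<Sum>d\<in>quots A A. rep A A d ^ (k + l))"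
    using A by (intro sum_mono2) (auto simp: popular_def)
  finally show ?thesis .
qed

text \<open>Counts below \<open>card A / 2 ^ J\<close> contribute at most half of the assumed
  energy, because \<open>2 * K \<le> 2 ^ J\<close>. The others are sorted into \<open>J\<close>
  dyadic levels. The factor 4 pays for the discarded half and for the ratio 2 within a
  level.\<close>

lemma ex_popular_level:
  fixes K :: real and J :: nat
  assumes A: "finite A" "A \<subseteq> carrier G" "A \<noteq> {}" and K: "0 < K" and J: "0 < J" "2 * K \<le> 2 ^ J"
    and energy: "real (card A) ^ 3 \<le> K * (\<Sum>x\<in>quots A A. rep A A x ^ 2)"
  shows "\<exists>\<tau>::real. 0 < \<tau> \<and> real (card A) ^ 3 \<le> 4 * J * K * \<tau> * (\<Sum>d\<in>popular A \<tau>. rep A A d)"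
proof -
  define n where "n = real (card A)"
  have n: "n > 0" using A by (simp add: n_def card_gt_0_iff)
  define r where "r = rep A A"
  have r0: "0 \<le> r d" for d by (simp add: r_def)
  have r_le: "r d \<le> n" for d using rep_le_card[OF A(1)] by (simp add: r_def n_def)
  define f where "f d = (if n / 2 ^ J \<le> r d then r d else 0)" for d
  let ?S = "quots A A"
  have "\<exists>j<J. (\<Sum>d\<in>?S. r d * f d) \<le> J * (n / 2 ^ j * (\<Sum>d | d \<in> ?S \<and> n / 2 ^ Suc j \<le> f d. r d))"
    using A n J by (intro dyadic_pigeonhole) (auto simp: f_def r_le r0)
  then obtain j where j: "(\<Sum>d\<in>?S. r d * f d) \<le> J * (n / 2 ^ j * (\<Sum>d | d \<in> ?S \<and> n / 2 ^ Suc j \<le> f d. r d))"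
    by blast
  define \<tau> where "\<tau> = n / 2 ^ Suc j"
  have \<tau>: "0 < \<tau>" using n by (simp add: \<tau>_def)
  have "(\<Sum>d | d \<in> ?S \<and> n / 2 ^ Suc j \<le> f d. r d) \<le> (\<Sum>d\<in>popular A \<tau>. r d)"
    using A \<tau> r0 by (intro sum_mono2) (auto simp: popular_def f_def r_def \<tau>_def split: if_splits)
  moreover have "n / 2 ^ j = 2 * \<tau>" by (simp add: \<tau>_def)
  ultimately have "(\<Sum>d\<in>?S. r d * f d) \<le> J * (2 * \<tau> * (\<Sum>d\<in>popular A \<tau>. r d))"
    using j \<tau> by (smt (verit) mult_left_mono of_nat_0_le_iff)
  moreover have "(\<Sum>d\<in>?S. r d ^ 2) \<le> (\<Sum>d\<in>?S. r d * f d) + n ^ 3 / 2 ^ J"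
  proof -
    have "(\<Sum>d\<in>?S. r d ^ 2) \<le> (\<Sum>d\<in>?S. r d * (f d + n / 2 ^ J))"
      unfolding power2_eq_square using n r0 by (intro sum_mono mult_left_mono) (auto simp: f_def)
    also have "\<dots> = (\<Sum>d\<in>?S. r d * f d) + (\<Sum>d\<in>?S. r d) * (n / 2 ^ J)"
      by (simp only: distrib_left sum.distrib sum_distrib_right)
    also have "(\<Sum>d\<in>?S. r d) = n * n"
      using sum_rep_eq[OF A(1,2) A(1,2)] by (simp add: r_def n_def)
    finally show ?thesis by (simp add: power3_eq_cube)
  qed
  moreover have "K * (n ^ 3 / 2 ^ J) \<le> n ^ 3 / 2"
  proof -
    have "n ^ 3 * (2 * K) \<le> n ^ 3 * 2 ^ J" using J n by (intro mult_left_mono) auto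
    then show ?thesis by (simp add: field_simps)
  qed
  moreover have "n ^ 3 \<le> K * (\<Sum>d\<in>?S. r d ^ 2)" using energy by (simp add: n_def r_def)
  ultimately have "n ^ 3 \<le> K * (J * (2 * \<tau> * (\<Sum>d\<in>popular A \<tau>. r d))) + n ^ 3 / 2"
    using K by (smt (verit) distrib_left mult_left_mono)
  then have "n ^ 3 \<le> 4 * J * K * \<tau> * (\<Sum>d\<in>popular A \<tau>. r d)"
    by (simp add: mult_ac)
  then show ?thesis using \<tau> by (auto simp: n_def r_def)
qed

text \<open>The squares of counts from \<open>\<theta>\<^sub>1\<close> on lie between
  \<open>\<theta>\<^sub>1 ^ 2\<close> and \<open>card A ^ 2\<close>, a range covered by
  \<open>J\<close> dyadic levels.\<close>

lemma ex_popular_count: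
  fixes \<theta>\<^sub>1 :: real and J :: nat
  assumes A: "finite A" "A \<subseteq> carrier G" "A \<noteq> {}" and P: "finite P" "P \<subseteq> carrier G"
    and J: "0 < J" "real (card A) ^ 2 \<le> 2 ^ J * \<theta>\<^sub>1 ^ 2" and \<theta>\<^sub>1: "0 < \<theta>\<^sub>1"
  shows "\<exists>\<theta>::real. \<theta>\<^sub>1 \<le> \<theta> \<and> (\<Sum>\<alpha>\<in>P. \<Sum>\<beta>\<in>P. of_bool (\<theta>\<^sub>1 \<le> rep A A (\<alpha> \<oslash> \<beta>)) * rep A A (\<alpha> \<oslash> \<beta>) ^ 2)
       \<le> 2 * J * \<theta> ^ 2 * (\<Sum>\<alpha>\<in>P. \<Sum>\<beta>\<in>P. of_bool (\<alpha> \<oslash> \<beta> \<in> popular A \<theta>))"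
proof -
  define n where "n = real (card A)"
  have n: "n > 0" using A by (simp add: n_def card_gt_0_iff)
  define r where "r q = rep A A (fst q \<oslash> snd q)" for q
  have r0: "0 \<le> r d" for d by (simp add: r_def)
  have r_le: "r d \<le> n" for d using rep_le_card[OF A(1)] by (simp add: r_def n_def)
  define f where "f q = (if \<theta>\<^sub>1 \<le> r q then r q ^ 2 else 0)" for q
  have f: "f q = 0 \<or> n ^ 2 / 2 ^ J \<le> f q \<and> f q \<le> n ^ 2" for q
  proof (cases "\<theta>\<^sub>1 \<le> r q")
    case True
    then have "\<theta>\<^sub>1 ^ 2 \<le> r q ^ 2" "r q ^ 2 \<le> n ^ 2"
      using \<theta>\<^sub>1 r_le[of q] r0[of q] True by (auto intro!: power_mono simp del: split_paired_All)
    moreover have "n ^ 2 / 2 ^ J \<le> \<theta>\<^sub>1 ^ 2" using J by (simp add: n_def field_simps)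
    ultimately show ?thesis using True by (simp add: f_def)
  qed (simp add: f_def)
  have "\<exists>j<J. (\<Sum>q\<in>P \<times> P. 1 * f q) \<le> J * (n ^ 2 / 2 ^ j * (\<Sum>q | q \<in> P \<times> P \<and> n ^ 2 / 2 ^ Suc j \<le> f q. 1))"
    using P n J f by (intro dyadic_pigeonhole) auto
  then obtain j where j: "(\<Sum>q\<in>P \<times> P. 1 * f q) \<le> J * (n ^ 2 / 2 ^ j * (\<Sum>q | q \<in> P \<times> P \<and> n ^ 2 / 2 ^ Suc j \<le> f q. 1))"
    by blast
  \<comment> \<open>The lower end of a level can lie below \<open>\<theta>\<^sub>1\<close>, hence
    the maximum.\<close>
  define \<theta> where "\<theta> = max \<theta>\<^sub>1 (sqrt (n ^ 2 / 2 ^ Suc j))"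
  have \<theta>: "\<theta>\<^sub>1 \<le> \<theta>" "n ^ 2 / 2 ^ j \<le> 2 * \<theta> ^ 2"
  proof -
    have "sqrt (n ^ 2 / 2 ^ Suc j) ^ 2 \<le> \<theta> ^ 2"
      unfolding \<theta>_def by (rule power_mono) auto
    then show "n ^ 2 / 2 ^ j \<le> 2 * \<theta> ^ 2" by simp
  qed (simp add: \<theta>_def)
  have "{q. q \<in> P \<times> P \<and> n ^ 2 / 2 ^ Suc j \<le> f q} \<subseteq> {q \<in> P \<times> P. fst q \<oslash> snd q \<in> popular A \<theta>}"
  proof
    fix q assume "q \<in> {q. q \<in> P \<times> P \<and> n ^ 2 / 2 ^ Suc j \<le> f q}"
    moreover obtain \<alpha> \<beta> where [simp]: "q = (\<alpha>, \<beta>)" by (cases q)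
    ultimately have q: "\<alpha> \<in> P" "\<beta> \<in> P" and le: "n ^ 2 / 2 ^ Suc j \<le> f (\<alpha>, \<beta>)" by auto
    then have f0: "f (\<alpha>, \<beta>) > 0" using n by (smt (verit) divide_pos_pos zero_less_power)
    then have ge: "\<theta>\<^sub>1 \<le> r (\<alpha>, \<beta>)" and fr: "f (\<alpha>, \<beta>) = r (\<alpha>, \<beta>) ^ 2"
      by (auto simp: f_def split: if_splits)
    have "sqrt (n ^ 2 / 2 ^ Suc j) \<le> r (\<alpha>, \<beta>)"
      using le fr r0 by (intro real_le_lsqrt) auto
    with ge have "\<theta> \<le> rep A A (\<alpha> \<oslash> \<beta>)" by (simp add: \<theta>_def r_def)
    moreover have "\<alpha> \<oslash> \<beta> \<in> quots A A"
    proof (rule ccontr)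
      assume "\<alpha> \<oslash> \<beta> \<notin> quots A A"
      then have "rep A A (\<alpha> \<oslash> \<beta>) = 0" using q P A by (intro rep_eq_0) (auto simp: subset_iff)
      then show False using \<open>\<theta> \<le> rep A A (\<alpha> \<oslash> \<beta>)\<close> \<theta>\<^sub>1 \<theta>(1) by simp
    qed
    ultimately show "q \<in> {q \<in> P \<times> P. fst q \<oslash> snd q \<in> popular A \<theta>}"
      using q by (simp add: popular_def)
  qed
  then have "card {q. q \<in> P \<times> P \<and> n ^ 2 / 2 ^ Suc j \<le> f q}
      \<le> card {q \<in> P \<times> P. fst q \<oslash> snd q \<in> popular A \<theta>}"
    using P by (intro card_mono) auto
  also have "real \<dots> = (\<Sum>q\<in>P \<times> P. of_bool (fst q \<oslash> snd q \<in> popular A \<theta>))"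
    using P by (intro sum_of_bool_eq_card[symmetric]) auto
  also have "\<dots> = (\<Sum>\<alpha>\<in>P. \<Sum>\<beta>\<in>P. of_bool (\<alpha> \<oslash> \<beta> \<in> popular A \<theta>))"
    by (simp only: sum.cartesian_product case_prod_unfold)
  finally have count: "real (card {q. q \<in> P \<times> P \<and> n ^ 2 / 2 ^ Suc j \<le> f q})
      \<le> (\<Sum>\<alpha>\<in>P. \<Sum>\<beta>\<in>P. of_bool (\<alpha> \<oslash> \<beta> \<in> popular A \<theta>))" by simp
  have "(\<Sum>\<alpha>\<in>P. \<Sum>\<beta>\<in>P. of_bool (\<theta>\<^sub>1 \<le> rep A A (\<alpha> \<oslash> \<beta>)) * rep A A (\<alpha> \<oslash> \<beta>) ^ 2)
      = (\<Sum>q\<in>P \<times> P. 1 * f q)"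
    unfolding sum.cartesian_product by (intro sum.cong) (auto simp: f_def r_def)
  also have "\<dots> \<le> J * (n ^ 2 / 2 ^ j * real (card {q. q \<in> P \<times> P \<and> n ^ 2 / 2 ^ Suc j \<le> f q}))"
    using j by (simp only: real_of_card)
  also have "\<dots> \<le> J * (2 * \<theta> ^ 2 * (\<Sum>\<alpha>\<in>P. \<Sum>\<beta>\<in>P. of_bool (\<alpha> \<oslash> \<beta> \<in> popular A \<theta>)))"
    using \<theta> count by (intro mult_left_mono mult_mono) auto
  finally show ?thesis using \<theta> by (intro exI[of _ \<theta>]) (simp add: mult_ac)
qed

lemma structured_mono:
  assumes "structured C K A" "C \<le> C'"
  shows "structured C' K A"
proof -
  obtain A' where A': "A' \<subseteq> A" "K powr (- 100 / 81) * real (card A) \<le> C * real (card A')"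
    "real (card (quots A' A')) \<le> C * (K powr (100 / 27) * real (card A'))"
    using assms(1) by (auto simp: structured_def)
  have "C * real (card A') \<le> C' * real (card A')"
    "C * (K powr (100 / 27) * real (card A')) \<le> C' * (K powr (100 / 27) * real (card A'))"
    using assms(2) by (intro mult_right_mono; simp)+
  with A' show ?thesis unfolding structured_def by (intro exI[of _ A']) linarith
qed

text \<open>Cauchy--Schwarz makes the third moment large with \<open>\<kappa> = 1 / K ^ 2\<close>.
  The powers of \<open>K\<close> lost in this direct argument are absorbed by
  \<open>K\<^sub>0 ^ 4\<close>.\<close>

lemma energy_imp_structured_bounded:
  fixes K K\<^sub>0 :: real
  assumes A: "finite A" "A \<subseteq> carrier G" "A \<noteq> {}" and K: "1 \<le> K" "K \<le> K\<^sub>0"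
    and energy: "real (card A) ^ 3 \<le> K * (\<Sum>x\<in>quots A A. rep A A x ^ 2)"
  shows "structured (1024 * K\<^sub>0 ^ 4) K A"
proof -
  define n where "n = real (card A)"
  have n: "n > 0" using A by (simp add: n_def card_gt_0_iff)
  define E where "E = (\<Sum>x\<in>quots A A. rep A A x ^ 2)"
  define E3 where "E3 = (\<Sum>x\<in>quots A A. rep A A x ^ 3)"
  have "n ^ 3 \<le> K * E" using energy by (simp add: n_def E_def)
  then have "(n ^ 3) ^ 2 \<le> (K * E) ^ 2" using n by (intro power_mono) auto
  also have "\<dots> = K ^ 2 * E ^ 2" by (rule power_mult_distrib)
  also have "\<dots> \<le> K ^ 2 * (n * n * E3)"
    using second_moment_le[OF A(1,2) A(1,2)] by (intro mult_left_mono) (auto simp: n_def E_def E3_def)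
  finally have "n ^ 4 * n ^ 2 \<le> (K ^ 2 * E3) * n ^ 2"
    by (simp add: power2_eq_square mult_ac numeral_eq_Suc)
  then have "n ^ 4 \<le> K ^ 2 * E3" by (rule mult_right_le_imp_le) (use n in simp)
  then have "1 / K ^ 2 * n ^ 2 * n ^ 2 \<le> E3"
    using K by (simp add: field_simps power2_eq_square power4_eq_xxxx)
  then obtain A' where A': "A' \<subseteq> A" "1 / K ^ 2 * n * n \<le> 16 * real (card A') ^ 2"
    "card (quots A' A') * (1 / K ^ 2) ^ 2 \<le> 1024 * real (card A')"
    using large_third_moment_imp_structure[OF A(1,2) A(1,2) _ A(3) A(3), of "1 / K ^ 2"] K
    by (auto simp: n_def E3_def)
  have K4: "K \<le> K\<^sub>0 ^ 4" "K ^ 4 \<le> K\<^sub>0 ^ 4"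
  proof -
    show "K ^ 4 \<le> K\<^sub>0 ^ 4" using K by (intro power_mono) auto
    moreover have "K ^ 1 \<le> K ^ 4" using K by (intro power_increasing) auto
    ultimately show "K \<le> K\<^sub>0 ^ 4" by simp
  qed
  have "(n / K) ^ 2 \<le> (4 * real (card A')) ^ 2"
    using A'(2) by (simp add: power2_eq_square mult_ac)
  then have "n / K \<le> 4 * real (card A')" by (rule power2_le_imp_le) simp
  then have "n \<le> K * (4 * card A')" using K by (simp add: field_simps)
  also have "\<dots> \<le> K\<^sub>0 ^ 4 * (1024 * card A')" using K4 K by (intro mult_mono) auto
  finally have n_le: "n \<le> 1024 * K\<^sub>0 ^ 4 * card A'" by (simp add: mult_ac)
  have "K powr (- 100 / 81) \<le> 1" using powr_mono[of "- 100 / 81" 0 K] K by simp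
  then have "K powr (- 100 / 81) * n \<le> 1 * n" using n by (intro mult_right_mono) auto
  with n_le have 1: "K powr (- 100 / 81) * n \<le> 1024 * K\<^sub>0 ^ 4 * card A'" by linarith
  have "card (quots A' A') \<le> K ^ 4 * (1024 * real (card A'))"
    using A'(3) K by (simp add: field_simps power2_eq_square power4_eq_xxxx)
  also have "\<dots> \<le> K\<^sub>0 ^ 4 * (1024 * real (card A'))" using K4 by (intro mult_right_mono) auto
  also have "\<dots> \<le> K\<^sub>0 ^ 4 * (1024 * (K powr (100 / 27) * real (card A')))"
  proof -
    have "1 \<le> K powr (100 / 27)" using K by (intro ge_one_powr_ge_zero) auto
    then have "1 * real (card A') \<le> K powr (100 / 27) * real (card A')" by (intro mult_right_mono) auto
    moreover have "0 \<le> K\<^sub>0 ^ 4" by simp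
    ultimately show ?thesis by (intro mult_left_mono) auto
  qed
  finally have "card (quots A' A') \<le> 1024 * K\<^sub>0 ^ 4 * (K powr (100 / 27) * card A')"
    by (simp add: mult_ac)
  with 1 show ?thesis using A'(1) unfolding structured_def n_def by blast
qed

text \<open>With \<open>card A\<close> as unit and exponents to the base \<open>K\<close>, the extreme case has \<open>- 23 / 27\<close> for \<open>\<tau>\<close>,
  \<open>19 / 27\<close> for \<open>card P\<close> and \<open>- 20 / 27\<close> for \<open>Q\<close>. The thresholds \<open>- 7 / 8\<close>, \<open>- 37 / 50\<close>, \<open>- 101 / 250\<close>,
  \<open>- 16 / 25\<close> and the exponent \<open>- 1829 / 1000\<close> are chosen such that every upper bound for a part of
  \<open>Q\<close> then stays below \<open>- 20 / 27\<close> by at least \<open>3 / 1000\<close>, which absorbs the constants and the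
  powers of \<open>J\<close>.\<close>
lemma energy_imp_structured_large:
  fixes K :: real and J :: nat
  assumes A: "finite A" "A \<subseteq> carrier G" "A \<noteq> {}" and K: "1 \<le> K"
    and J: "0 < J" "64 * K ^ 2 \<le> 2 ^ J" "2 ^ 19 * real J ^ 2 \<le> K powr (1 / 10000)"
    and energy: "real (card A) ^ 3 \<le> K * (\<Sum>x\<in>quots A A. rep A A x ^ 2)"
  shows "structured 1024 K A"
proof (rule ccontr)
  assume ns: "\<not> structured 1024 K A"
  define n where "n = real (card A)"
  have n: "n > 0" using A by (simp add: n_def card_gt_0_iff)
  have K0: "0 < K" using K by simp
  have Jr: "1 \<le> real J" using J by simp
  \<comment> \<open>On the logarithmic scale all estimates become linear, so that every comparison
    of powers is left to linear arithmetic.\<close>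
  define k \<nu> lJ L where "k = ln K" and "\<nu> = ln n" and "lJ = ln (real J)" and "L = ln (2::real)"
  have L: "0 < L" by (simp add: L_def)
  have lJ: "0 \<le> lJ" using Jr by (simp add: lJ_def)
  have ln_pow2: "ln (4::real) = 2 * L" "ln (8::real) = 3 * L" "ln (32::real) = 5 * L"
      "ln (64::real) = 6 * L" "ln (1024::real) = 10 * L" "ln (16384::real) = 14 * L"
      "ln (524288::real) = 19 * L"
    using ln_realpow[of "2::real" 2] ln_realpow[of "2::real" 3] ln_realpow[of "2::real" 5]
      ln_realpow[of "2::real" 6] ln_realpow[of "2::real" 10] ln_realpow[of "2::real" 14]
      ln_realpow[of "2::real" 19]
    by (simp_all add: L_def)
  note logs = ln_mult ln_realpow ln_powr ln_div ln_pow2 k_def[symmetric] \<nu>_def[symmetric] lJ_def[symmetric] L_def[symmetric]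
  \<comment> \<open>Numerical constants and powers of \<open>J\<close> appear as multiples of
    \<open>L\<close> and \<open>lJ\<close>; this makes them negligible against
    \<open>k\<close>.\<close>
  have small: "19 * L + 2 * lJ \<le> k / 10000"
    using ln_leI[OF _ J(3)] Jr K0 by (simp add: logs)
  have k: "0 < k" using small L lJ by linarith
  let ?M = "K powr (- 50 / 27)"
  have sizeA: "K powr (- 200 / 81) * card A \<le> ?M * card A"
    using K by (intro mult_right_mono powr_mono) auto
  define E3 where "E3 = (\<Sum>x\<in>quots A A. rep A A x ^ 3)"
  have E3: "E3 \<le> ?M * n ^ 4"
    using not_structured_imp_third_moment_less[OF A(1,2) A(1,2) A(3) A(3) K0 ns order_refl sizeA]
    by (simp add: E3_def n_def power2_eq_square power4_eq_xxxx mult_ac)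
  have "K \<le> K ^ 2" using K by (simp add: power2_eq_square)
  then have "2 * K \<le> 2 ^ J" using J(2) K0 by linarith
  then obtain \<tau> where \<tau>: "0 < \<tau>" and
      level: "n ^ 3 \<le> 4 * J * K * \<tau> * (\<Sum>d\<in>popular A \<tau>. rep A A d)"
    using ex_popular_level[OF A K0 J(1) _ energy] by (auto simp: n_def)
  define P where "P = popular A \<tau>"
  have P: "finite P" "P \<subseteq> carrier G" using A popular_subset by (auto simp: P_def)
  define s where "s = (\<Sum>d\<in>P. rep A A d)"
  define p where "p = real (card P)"
  have s0: "0 < s"
  proof -
    have "0 < 4 * J * K * \<tau> * s" using level n by (simp add: s_def P_def less_le_trans[of 0 "n ^ 3"])
    moreover have "0 < 4 * J * K * \<tau>" using J(1) K0 \<tau> by simp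
    ultimately show ?thesis by (rule zero_less_mult_pos)
  qed
  then have Pne: "P \<noteq> {}" by (auto simp: s_def)
  then have p0: "0 < p" using P by (simp add: p_def card_gt_0_iff)
  define a \<sigma> \<pi> where "a = ln \<tau>" and "\<sigma> = ln s" and "\<pi> = ln p"
  note logs = logs a_def[symmetric] \<sigma>_def[symmetric] \<pi>_def[symmetric]
  have l1: "3 * \<nu> \<le> 2 * L + lJ + k + a + \<sigma>"
  proof -
    have "n ^ 3 \<le> 4 * J * K * \<tau> * s" using level by (simp add: s_def P_def)
    then show ?thesis using ln_leI[of "n ^ 3" "4 * J * K * \<tau> * s"] n Jr K0 \<tau> s0 by (simp add: logs)
  qed
  \<comment> \<open>Combined with \<open>l1\<close>, this gives \<open>\<tau>\<close> an exponent of
    at most about \<open>- 23 / 27\<close>: a more popular level would force a large third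
    moment.\<close>
  have l2: "2 * a + \<sigma> \<le> 4 * \<nu> - 50 / 27 * k"
  proof -
    have "\<tau> ^ 2 * s \<le> E3"
      using popular_moment_le[OF A(1,2), of \<tau> 2 1] \<tau> by (simp add: s_def P_def E3_def)
    then have "\<tau> ^ 2 * s \<le> ?M * n ^ 4" using E3 by linarith
    then show ?thesis using ln_leI[of "\<tau> ^ 2 * s" "?M * n ^ 4"] n K0 \<tau> s0 by (simp add: logs)
  qed
  have l3: "\<pi> + a \<le> \<sigma>"
  proof -
    have "p * \<tau> \<le> s"
      unfolding s_def p_def by (rule sum_bounded_below) (simp add: P_def popular_def)
    then show ?thesis using ln_leI[of "p * \<tau>" s] p0 \<tau> by (simp add: logs)
  qed
  have l4: "\<sigma> \<le> \<pi> + \<nu>"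
  proof -
    have "s \<le> p * n"
      unfolding s_def p_def n_def by (rule sum_bounded_above) (rule rep_le_card[OF A(1)])
    then show ?thesis using ln_leI[of s "p * n"] p0 s0 n by (simp add: logs)
  qed
  define Q where "Q = (\<Sum>\<alpha>\<in>P. \<Sum>\<beta>\<in>P. rep A A (\<alpha> \<oslash> \<beta>) ^ 2)"
  have Q_ge: "\<tau> ^ 2 * s ^ 6 \<le> ?M * n ^ 10 * Q"
  proof -
    have "(\<Sum>x\<in>A. \<Sum>y\<in>A. of_bool (x \<oslash> y \<in> P)) = (\<Sum>d\<in>quots A A. rep A A d * of_bool (d \<in> P))"
      by (rule sum_rep[OF A(1,2) A(1,2)])
    also have "\<dots> = (\<Sum>d\<in>quots A A. if \<tau> \<le> rep A A d then rep A A d else 0)"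
      by (intro sum.cong) (auto simp: P_def popular_def)
    also have "\<dots> = s"
      using A by (simp add: s_def P_def popular_def sum.inter_filter)
    finally have "\<tau> ^ 2 * s ^ 6 \<le> n ^ 6 * E3 * Q"
      unfolding n_def E3_def Q_def using \<tau> inv_popular[OF A(1,2)]
      by (intro popular_differences_second_moment[OF A(1,2) P]) (auto simp: P_def popular_def)
    also have "\<dots> \<le> n ^ 6 * (?M * n ^ 4) * Q"
      using E3 n by (intro mult_right_mono mult_left_mono) (auto simp: Q_def intro!: sum_nonneg)
    finally show ?thesis by (simp add: mult_ac numeral_eq_Suc)
  qed
  have Q0: "0 < Q"
  proof -
    have "0 < ?M * n ^ 10 * Q" using Q_ge \<tau> s0 by (smt (verit) mult_pos_pos zero_less_power)
    moreover have "0 < ?M * n ^ 10" using n K0 by simp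
    ultimately show ?thesis by (rule zero_less_mult_pos)
  qed
  define q where "q = ln Q"
  have l5: "2 * a + 6 * \<sigma> \<le> 10 * \<nu> - 50 / 27 * k + q"
    using ln_leI[OF _ Q_ge] \<tau> s0 n K0 Q0 by (simp add: logs q_def)
  define e where "e = (\<Sum>x\<in>quots A P. rep A P x ^ 2)"
  have sizeP: "K powr (- 200 / 81) * card A \<le> ?M * card P"
  proof -
    have "ln (K powr (- 200 / 81) * n) \<le> ln (?M * p)"
      using n p0 K0 l1 l2 l4 k small L lJ by (simp add: logs)
    then show ?thesis using n p0 K0 by (subst (asm) ln_le_cancel_iff) (auto simp: n_def p_def)
  qed
  have e2: "e ^ 2 \<le> ?M * n ^ 3 * p ^ 3"
    unfolding e_def n_def p_def
    by (rule not_structured_imp_second_moment_le[OF A(1,2) P A(3) Pne K0 ns order_refl sizeP])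
  define \<theta>\<^sub>a \<theta>\<^sub>1 where "\<theta>\<^sub>a = K powr (- 7 / 8) * n" and "\<theta>\<^sub>1 = K powr (- 37 / 50) * n"
  have \<theta>0: "0 < \<theta>\<^sub>a" "0 < \<theta>\<^sub>1" using n K0 by (auto simp: \<theta>\<^sub>a_def \<theta>\<^sub>1_def)
  have ln_\<theta>: "ln \<theta>\<^sub>a = \<nu> - 7 / 8 * k" "ln \<theta>\<^sub>1 = \<nu> - 37 / 50 * k"
    using n K0 by (simp_all add: \<theta>\<^sub>a_def \<theta>\<^sub>1_def logs)
  define V where "V = (\<Sum>\<alpha>\<in>P. \<Sum>\<beta>\<in>P. rep A A (\<alpha> \<oslash> \<beta>) * of_bool (\<theta>\<^sub>a \<le> rep A A (\<alpha> \<oslash> \<beta>)))"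
  define H where "H = (\<Sum>\<alpha>\<in>P. \<Sum>\<beta>\<in>P. of_bool (\<theta>\<^sub>1 \<le> rep A A (\<alpha> \<oslash> \<beta>)) * rep A A (\<alpha> \<oslash> \<beta>) ^ 2)"
  have split: "Q \<le> \<theta>\<^sub>a * e + \<theta>\<^sub>1 * V + H"
  proof -
    have e_eq: "e = (\<Sum>\<alpha>\<in>P. \<Sum>\<beta>\<in>P. rep A A (\<alpha> \<oslash> \<beta>))"
      unfolding e_def by (rule sum_rep_quots_eq_second_moment[OF A(1,2) P, symmetric])
    have "r ^ 2 \<le> \<theta>\<^sub>a * r + \<theta>\<^sub>1 * (r * of_bool (\<theta>\<^sub>a \<le> r)) + of_bool (\<theta>\<^sub>1 \<le> r) * r ^ 2" if "0 \<le> r" for r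
    proof -
      have "0 \<le> \<theta>\<^sub>a * r" "0 \<le> \<theta>\<^sub>1 * r" using that \<theta>0 by auto
      moreover have "r \<le> \<theta>\<^sub>a \<Longrightarrow> r * r \<le> \<theta>\<^sub>a * r" "r \<le> \<theta>\<^sub>1 \<Longrightarrow> r * r \<le> \<theta>\<^sub>1 * r"
        using that by (auto intro: mult_right_mono)
      ultimately show ?thesis
        unfolding power2_eq_square by (cases "\<theta>\<^sub>a \<le> r"; cases "\<theta>\<^sub>1 \<le> r") auto
    qed
    then show ?thesis
      unfolding Q_def e_eq V_def H_def sum_distrib_left sum.distrib[symmetric]
      by (intro sum_mono) auto
  qed
  \<comment> \<open>Division by 4 instead of 3 leaves only powers of 2 in the logarithms.\<close>
  then consider "Q / 4 \<le> \<theta>\<^sub>a * e" | "Q / 4 \<le> \<theta>\<^sub>1 * V" | "Q / 4 \<le> H" using Q0 by linarith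
  then show False
  proof cases
    \<comment> \<open>Small values: the mixed energy \<open>e\<close> is too small, by the third
      moment for \<open>P\<close>.\<close>
    case 1
    then have "0 < \<theta>\<^sub>a * e" using Q0 by linarith
    then have e0: "0 < e" using \<theta>0 by (simp add: zero_less_mult_iff)
    have "2 * ln e \<le> 3 * \<nu> + 3 * \<pi> - 50 / 27 * k"
      using ln_leI[OF _ e2] e0 n p0 K0 by (simp add: logs)
    moreover have "q - 2 * L \<le> \<nu> - 7 / 8 * k + ln e"
      using ln_leI[OF _ 1] Q0 \<theta>0 e0 by (simp add: logs q_def ln_\<theta>)
    ultimately show False using l1 l2 l3 l5 k small L lJ by linarith
  next
    \<comment> \<open>Middle values: \<open>V\<close> is then large enough for
      \<open>two_scale_structure\<close> to yield a structured subset.\<close>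
    case 2
    then have "0 < \<theta>\<^sub>1 * V" using Q0 by linarith
    then have V0: "0 < V" using \<theta>0 by (simp add: zero_less_mult_iff)
    define v where "v = ln V"
    have lV: "q - 2 * L \<le> \<nu> - 37 / 50 * k + v"
      using ln_leI[OF _ 2] Q0 \<theta>0 V0 by (simp add: logs q_def ln_\<theta> v_def)
    have V_eq: "V \<le> (\<Sum>a\<in>A. \<Sum>b\<in>A. of_bool (\<theta>\<^sub>a \<le> rep A A (a \<oslash> b)) * rep P P (a \<oslash> b))"
      using sum_rep_swap[OF A(1,2) P, of "\<lambda>d. of_bool (\<theta>\<^sub>a \<le> rep A A d)"]
      by (simp add: V_def mult.commute)
    have "8 * real (card A) ^ 2 * card P \<le> 2 ^ J * V"
    proof -
      have "ln (8 * n ^ 2 * p) \<le> ln (64 * K ^ 2 * V)"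
        using n p0 K0 V0 lV l1 l2 l3 l5 k small L lJ by (simp add: logs v_def[symmetric])
      then have "8 * n ^ 2 * p \<le> 64 * K ^ 2 * V"
        using n p0 K0 V0 by (subst (asm) ln_le_cancel_iff) auto
      also have "\<dots> \<le> 2 ^ J * V" using J(2) V0 by (intro mult_right_mono) auto
      finally show ?thesis by (simp add: n_def p_def)
    qed
    then obtain Y where Y: "Y \<subseteq> A" "V \<le> 32 * J * card A * card P * card Y"
        "card (quots Y Y) * (V ^ 3 * \<theta>\<^sub>a)
           \<le> 16384 * real J ^ 2 * real (card A) ^ 6 * real (card P) ^ 4 * card Y"
      using two_scale_structure[OF A(1,2) P A(3) Pne \<theta>0(1) V0 J(1) V_eq] by blast
    define y where "y = real (card Y)"
    have Y1: "V \<le> 32 * J * n * p * y" and Y2: "card (quots Y Y) * (V ^ 3 * \<theta>\<^sub>a)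
           \<le> 16384 * real J ^ 2 * n ^ 6 * p ^ 4 * y"
      using Y by (simp_all add: n_def p_def y_def)
    have "0 < 32 * J * n * p * y" using Y1 V0 by linarith
    moreover have "0 < 32 * J * n * p" using J(1) n p0 by simp
    ultimately have y0: "0 < y" by (rule zero_less_mult_pos)
    have ly: "v \<le> 5 * L + lJ + \<nu> + \<pi> + ln y"
      using ln_leI[OF V0 Y1] Jr n p0 y0 by (simp add: logs v_def)
    have "ln (K powr (- 100 / 81) * n) \<le> ln (1024 * y)"
      using n y0 K0 ly lV l1 l2 l3 l5 k small L lJ by (simp add: logs)
    then have size: "K powr (- 100 / 81) * n \<le> 1024 * y"
      using n y0 K0 by (subst (asm) ln_le_cancel_iff) auto
    define c where "c = real (card (quots Y Y))"
    have "Y \<noteq> {}" using y0 by (auto simp: y_def)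
    then have "quots Y Y \<noteq> {}" by (auto simp: quots_def)
    moreover have "finite Y" using Y(1) A finite_subset by auto
    ultimately have c0: "0 < c" by (simp add: c_def card_gt_0_iff)
    have "ln c + 3 * v + \<nu> - 7 / 8 * k \<le> 14 * L + 2 * lJ + 6 * \<nu> + 4 * \<pi> + ln y"
      using ln_leI[OF _ Y2] Jr n p0 y0 c0 V0 \<theta>0
      by (simp add: logs v_def ln_\<theta> c_def[symmetric])
    then have "ln c \<le> ln (1024 * (K powr (100 / 27) * y))"
      using n y0 K0 lV l1 l2 l3 l5 k small L lJ by (simp add: logs)
    then have "c \<le> 1024 * (K powr (100 / 27) * y)"
      using c0 y0 K0 by (subst (asm) ln_le_cancel_iff) auto
    with size Y(1) have "structured 1024 K A"
      unfolding structured_def n_def y_def c_def by blast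
    then show False using ns by simp
  next
    \<comment> \<open>Large values: one level \<open>\<theta>\<close> of very popular quotients
      carries a share of \<open>Q\<close>, and the pairs on it are counted.\<close>
    case 3
    have "n ^ 2 \<le> 2 ^ J * \<theta>\<^sub>1 ^ 2"
    proof -
      have "ln (n ^ 2) \<le> ln (64 * K ^ 2 * \<theta>\<^sub>1 ^ 2)"
        using n K0 \<theta>0 k L by (simp add: logs ln_\<theta>)
      then have "n ^ 2 \<le> 64 * K ^ 2 * \<theta>\<^sub>1 ^ 2"
        using n K0 \<theta>0 by (subst (asm) ln_le_cancel_iff) auto
      also have "\<dots> \<le> 2 ^ J * \<theta>\<^sub>1 ^ 2" using J(2) by (intro mult_right_mono) auto
      finally show ?thesis .
    qed
    then obtain \<theta> :: real where \<theta>: "\<theta>\<^sub>1 \<le> \<theta>"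
      "H \<le> 2 * J * \<theta> ^ 2 * (\<Sum>\<alpha>\<in>P. \<Sum>\<beta>\<in>P. of_bool (\<alpha> \<oslash> \<beta> \<in> popular A \<theta>))"
      using ex_popular_count[OF A P J(1) _ \<theta>0(2)] by (auto simp: n_def H_def)
    define D where "D = popular A \<theta>"
    have D: "finite D" "D \<subseteq> carrier G" using A popular_subset by (auto simp: D_def)
    define N where "N = (\<Sum>\<alpha>\<in>P. \<Sum>\<beta>\<in>P. of_bool (\<alpha> \<oslash> \<beta> \<in> D) :: real)"
    have \<theta>pos: "0 < \<theta>" using \<theta> \<theta>0 by linarith
    have QN: "Q / 4 \<le> 2 * J * \<theta> ^ 2 * N" using 3 \<theta>(2) by (simp add: N_def D_def)
    then have "0 < 2 * J * \<theta> ^ 2 * N" using Q0 by linarith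
    moreover have "0 < 2 * J * \<theta> ^ 2" using J(1) \<theta>pos by simp
    ultimately have N0: "0 < N" by (rule zero_less_mult_pos)
    define t d where "t = ln \<theta>" and "d = ln (real (card D))"
    have lt: "\<nu> - 37 / 50 * k \<le> t" using ln_leI[OF \<theta>0(2) \<theta>(1)] by (simp add: ln_\<theta> t_def)
    have N_le: "N \<le> p * card D"
      unfolding N_def p_def by (rule count_quots_in_le[OF P D(1)])
    have "0 < p * card D" using N_le N0 by linarith
    then have D0: "0 < real (card D)" using p0 by (simp add: zero_less_mult_iff)
    then have Dne: "D \<noteq> {}" by auto
    have lN: "ln N \<le> \<pi> + d" using ln_leI[OF N0 N_le] p0 D0 by (simp add: logs d_def)
    have lQ: "q - 2 * L \<le> L + lJ + 2 * t + ln N"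
      using ln_leI[OF _ QN] Q0 Jr \<theta>pos N0 by (simp add: logs q_def t_def)
    have ld: "3 * t + d \<le> 4 * \<nu> - 50 / 27 * k"
    proof -
      have "\<theta> ^ 3 * card D \<le> E3"
        using popular_moment_le[OF A(1,2), of \<theta> 3 0] \<theta>pos by (simp add: D_def E3_def)
      then have "\<theta> ^ 3 * card D \<le> ?M * n ^ 4" using E3 by linarith
      then show ?thesis
        using ln_leI[of "\<theta> ^ 3 * card D" "?M * n ^ 4"] n K0 \<theta>pos D0 by (simp add: logs t_def d_def)
    qed
    consider "\<nu> - 101 / 250 * k \<le> t" | "t \<le> \<nu> - 101 / 250 * k" "d \<le> \<nu> - 16 / 25 * k"
      | "t \<le> \<nu> - 101 / 250 * k" "\<nu> - 16 / 25 * k \<le> d" by linarith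
    then show False
    proof cases
      \<comment> \<open>For high \<open>\<theta>\<close> the third moment of \<open>A\<close> makes
        \<open>D\<close> so small that the trivial count \<open>N \<le> p * card D\<close>
        suffices.\<close>
      case 1
      then show False using lQ lN ld l1 l2 l3 l5 k small L lJ by linarith
    next
      \<comment> \<open>Here \<open>D\<close> is small by the case assumption, and the trivial count
        suffices again.\<close>
      case 2
      then show False using lQ lN ld l1 l2 l3 l5 k small L lJ by linarith
    next
      case 3
      \<comment> \<open>As \<open>D\<close> may be as small as
        \<open>K powr (- 16 / 25) * n\<close>, the size condition requires a larger
        \<open>\<kappa>\<close> than for \<open>P\<close>: the exponent lies just above
        \<open>- 200 / 81 + 16 / 25\<close>.\<close>
      have \<kappa>: "?M \<le> K powr (- 1829 / 1000)" using K by (intro powr_mono) auto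
      have sizeD: "K powr (- 200 / 81) * card A \<le> K powr (- 1829 / 1000) * card D"
      proof -
        have "ln (K powr (- 200 / 81) * n) \<le> ln (K powr (- 1829 / 1000) * card D)"
          using n D0 K0 3 k by (simp add: logs d_def[symmetric])
        then show ?thesis using n D0 K0 by (subst (asm) ln_le_cancel_iff) (auto simp: n_def)
      qed
      define e' where "e' = (\<Sum>x\<in>quots A D. rep A D x ^ 2)"
      have e'2: "e' ^ 2 \<le> K powr (- 1829 / 1000) * n ^ 3 * real (card D) ^ 3"
        unfolding e'_def n_def
        by (rule not_structured_imp_second_moment_le[OF A(1,2) D A(3) Dne K0 ns \<kappa> sizeD])
      have prod: "(\<tau> * N) ^ 2 \<le> e * e'"
        unfolding N_def e_def e'_def using \<tau> inv_popular[OF A(1,2)]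
        by (intro count_popular_quots_le[OF A(1,2) P D]) (auto simp: P_def D_def popular_def)
      have "0 < e * e'" using prod \<tau> N0 by (smt (verit) mult_pos_pos zero_less_power)
      moreover have "0 \<le> e" "0 \<le> e'" by (auto simp: e_def e'_def intro!: sum_nonneg)
      ultimately have e0: "0 < e" "0 < e'" by (auto simp: zero_less_mult_iff)
      have "2 * ln e \<le> 3 * \<nu> + 3 * \<pi> - 50 / 27 * k"
        using ln_leI[OF _ e2] e0 n p0 K0 by (simp add: logs)
      moreover have "2 * ln e' \<le> 3 * \<nu> + 3 * d - 1829 / 1000 * k"
        using ln_leI[OF _ e'2] e0 n D0 K0 by (simp add: logs d_def)
      moreover have "2 * (a + ln N) \<le> ln e + ln e'"
        using ln_leI[OF _ prod] \<tau> N0 e0 by (simp add: logs)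
      ultimately have "4 * ln N \<le> 6 * \<nu> + 3 * \<pi> + 3 * d - 4 * a - (50 / 27 + 1829 / 1000) * k"
        by (simp add: algebra_simps)
      moreover have "3 * d \<le> 12 * \<nu> - 50 / 9 * k - 9 * t" using ld by simp
      \<comment> \<open>The multiples \<open>8 * t\<close> from \<open>lQ\<close> and
        \<open>- 9 * t\<close> from \<open>ld\<close> leave \<open>- t\<close>, so the lower bound
        \<open>lt\<close> applies and contributes \<open>37 / 50\<close>.\<close>
      ultimately have "4 * q \<le> 12 * L + 4 * lJ + 17 * \<nu> + 3 * \<pi> - 4 * a
          - (50 / 27 + 1829 / 1000 + 50 / 9 - 37 / 50) * k"
        using lQ lt by (simp add: algebra_simps)
      then show False using l1 l2 l3 l5 k small L lJ by (simp add: algebra_simps)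
    qed
  qed
qed

end

text \<open>\<open>J\<close> is \<open>log 2 (64 * K ^ 2)\<close> rounded up; the square of a
  logarithm is eventually below any positive power of \<open>K\<close>.\<close>

lemma ex_dyadic_depth:
  "\<exists>K\<^sub>0\<ge>1. \<forall>K\<ge>K\<^sub>0. \<exists>J>0. 64 * K ^ 2 \<le> 2 ^ J \<and> 2 ^ 19 * real J ^ 2 \<le> K powr (1 / 10000)"
proof -
  have "eventually (\<lambda>K::real. 2 ^ 19 * (log 2 (64 * K ^ 2) + 1) ^ 2 \<le> K powr (1 / 10000)) at_top"
    by real_asymp
  then obtain K\<^sub>0 :: real where
    K\<^sub>0: "\<And>K. K \<ge> K\<^sub>0 \<Longrightarrow> 2 ^ 19 * (log 2 (64 * K ^ 2) + 1) ^ 2 \<le> K powr (1 / 10000)"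
    by (auto simp: eventually_at_top_linorder)
  have "\<exists>J>0. 64 * K ^ 2 \<le> 2 ^ J \<and> 2 ^ 19 * real J ^ 2 \<le> K powr (1 / 10000)"
    if K: "K \<ge> max 1 K\<^sub>0" for K
  proof -
    define l where "l = log 2 (64 * K ^ 2)"
    have "1 \<le> K ^ 2" using K by simp
    then have l: "0 < l" unfolding l_def by (subst zero_less_log_cancel_iff) auto
    define J where "J = nat \<lceil>l\<rceil>"
    have J: "l \<le> real J" "real J \<le> l + 1" "0 < J" using l by (auto simp: J_def)
    have "64 * K ^ 2 = 2 powr l" using \<open>1 \<le> K ^ 2\<close> unfolding l_def by (subst powr_log_cancel) linarith+
    also have "\<dots> \<le> 2 powr real J" using J by (intro powr_mono) auto
    also have "\<dots> = 2 ^ J" by (simp add: powr_realpow)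
    finally have 1: "64 * K ^ 2 \<le> 2 ^ J" .
    have "2 ^ 19 * real J ^ 2 \<le> 2 ^ 19 * (l + 1) ^ 2"
      using J by (intro mult_left_mono power_mono) auto
    also have "\<dots> \<le> K powr (1 / 10000)" using K\<^sub>0[of K] K by (simp add: l_def)
    finally show ?thesis using 1 J by blast
  qed
  then show ?thesis by (intro exI[of _ "max 1 K\<^sub>0"]) auto
qed

subsection \<open>Transfer from the natural numbers\<close>

text \<open>The formula is the one from which \<open>energy_const\<close> chooses, hence the type
  \<open>nat\<close>. Up to the absolute threshold \<open>K\<^sub>0\<close> the direct argument
  costs a constant; beyond it 1024 suffices.\<close>

lemma ex_energy_const:
  "\<exists>C. \<forall>(G :: nat monoid) A K.
       comm_group G \<longrightarrow> A \<subseteq> carrier G \<longrightarrow> finite A \<longrightarrow> A \<noteq> {} \<longrightarrow> K \<ge> 1 \<longrightarrow>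
       real (additive_energy G A) \<ge> inverse K * real (card A) ^ 3 \<longrightarrow>
       (\<exists>A'\<subseteq>A.
          K powr (- 100 / 81 - \<epsilon>) * real (card A) \<le> C * real (card A') \<and>
          real (card (difference_set G A')) \<le> C * (K powr (100 / 27 + \<epsilon>) * real (card A')))"
  if "0 < \<epsilon>"
proof -
  obtain K\<^sub>0 :: real where K\<^sub>0: "1 \<le> K\<^sub>0" "\<And>K. K\<^sub>0 \<le> K \<Longrightarrow>
      \<exists>J>0. 64 * K ^ 2 \<le> 2 ^ J \<and> 2 ^ 19 * real J ^ 2 \<le> K powr (1 / 10000)"
    using ex_dyadic_depth by blast
  define C where "C = 1024 * K\<^sub>0 ^ 4"
  have "1 \<le> K\<^sub>0 ^ 4" using K\<^sub>0(1) by (rule one_le_power)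
  then have C: "1024 \<le> C" by (simp add: C_def)
  show ?thesis
  proof (intro exI[of _ C] allI impI)
    fix G :: "nat monoid" and A and K :: real
    assume "comm_group G" and A: "A \<subseteq> carrier G" "finite A" "A \<noteq> {}" and K: "1 \<le> K"
      and energy: "inverse K * real (card A) ^ 3 \<le> real (additive_energy G A)"
    interpret comm_group G by fact
    have energy': "real (card A) ^ 3 \<le> K * (\<Sum>x\<in>quots A A. rep A A x ^ 2)"
      using energy K by (simp add: additive_energy_eq[OF A(2,1)] field_simps)
    have "structured C K A"
    proof (cases "K \<le> K\<^sub>0")
      case True
      then show ?thesis
        unfolding C_def by (intro energy_imp_structured_bounded[OF A(2,1,3) K _ energy'])
    next
      case False
      then obtain J where "0 < J" "64 * K ^ 2 \<le> 2 ^ J" "2 ^ 19 * real J ^ 2 \<le> K powr (1 / 10000)"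
        using K\<^sub>0(2)[of K] by auto
      then have "structured 1024 K A"
        by (rule energy_imp_structured_large[OF A(2,1,3) K _ _ _ energy'])
      then show ?thesis using C by (rule structured_mono)
    qed
    then obtain A' where A': "A' \<subseteq> A" "K powr (- 100 / 81) * real (card A) \<le> C * real (card A')"
      "real (card (quots A' A')) \<le> C * (K powr (100 / 27) * real (card A'))"
      by (auto simp: structured_def)
    have "K powr (- 100 / 81 - \<epsilon>) * real (card A) \<le> K powr (- 100 / 81) * real (card A)"
      using K that by (intro mult_right_mono powr_mono) auto
    moreover have "C * (K powr (100 / 27) * real (card A')) \<le> C * (K powr (100 / 27 + \<epsilon>) * real (card A'))"
      using K that C by (intro mult_left_mono mult_right_mono powr_mono) auto
    ultimately show "\<exists>A'\<subseteq>A.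
          K powr (- 100 / 81 - \<epsilon>) * real (card A) \<le> C * real (card A') \<and>
          real (card (difference_set G A')) \<le> C * (K powr (100 / 27 + \<epsilon>) * real (card A'))"
      using A' by (intro exI[of _ A']) (auto simp: difference_set_eq_quots)
  qed
qed

text \<open>Existence turns the \<open>SOME\<close> in \<open>energy_const\<close> into a constant
  with the required property.\<close>

lemmas energy_const_works = someI_ex[OF ex_energy_const, folded energy_const_def, rule_format]

section \<open>Copies of finitely generated subgroups on the natural numbers\<close>

context comm_group
begin

text \<open>Every element is the value of a word in the generators and their inverses, and there are
  only countably many words.\<close>

lemma countable_generate:
  assumes A: "countable A" "A \<subseteq> carrier G"
  shows "countable (generate G A)"
proof -
  define ev where "ev xs = foldr (\<otimes>) xs \<one>" for xs
  let ?L = "lists (A \<union> m_inv G ` A)"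
  have L: "x \<in> carrier G" if "x \<in> A \<union> m_inv G ` A" for x using that A by auto
  have closed: "ev xs \<in> carrier G" if "xs \<in> ?L" for xs
    using that by (induction rule: lists.induct) (use L in \<open>auto simp: ev_def\<close>)
  have append: "ev (xs @ ys) = ev xs \<otimes> ev ys" if "xs \<in> ?L" "ys \<in> ?L" for xs ys
    using that
  proof (induction rule: lists.induct)
    case Nil
    then show ?case using closed[OF Nil(1)] by (simp add: ev_def)
  next
    case (Cons x xs)
    then show ?case using closed[OF Cons(2)] closed[OF Cons(4)] L[OF Cons(1)]
      by (simp add: ev_def m_assoc)
  qed
  have "generate G A \<subseteq> ev ` ?L"
  proof
    fix x assume "x \<in> generate G A"
    then show "x \<in> ev ` ?L"
    proof (induction rule: generate.induct)
      case one
      show ?case by (rule image_eqI[of _ _ "[]"]) (auto simp: ev_def)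
    next
      case (incl h)
      then show ?case using L by (intro image_eqI[of _ _ "[h]"]) (auto simp: ev_def)
    next
      case (inv h)
      then show ?case using L by (intro image_eqI[of _ _ "[inv h]"]) (auto simp: ev_def)
    next
      case (eng h1 h2)
      then obtain xs ys where "xs \<in> ?L" "ys \<in> ?L" "h1 = ev xs" "h2 = ev ys" by auto
      then show ?case by (intro image_eqI[of _ _ "xs @ ys"]) (auto simp: append)
    qed
  qed
  moreover have "countable (ev ` ?L)" using A by (intro countable_image countable_lists) auto
  ultimately show ?thesis by (rule countable_subset)
qed

end

text \<open>The subgroup generated by \<open>A\<close> is countable, so its elements can be numbered
  and its operation transported. Energy and difference sets of subsets of \<open>A\<close> are
  formed inside this subgroup.\<close>

lemma ex_nat_copy:
  fixes G :: "'a monoid" (structure)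
  assumes "comm_group G" and A: "finite A" "A \<subseteq> carrier G"
  shows "\<exists>(N :: nat monoid) f. comm_group N \<and> inj_on f A \<and> f ` A \<subseteq> carrier N
    \<and> additive_energy N (f ` A) = additive_energy G A
    \<and> (\<forall>B\<subseteq>A. card (difference_set N (f ` B)) = card (difference_set G B))"
proof -
  interpret comm_group G by fact
  define H where "H = generate G A"
  have H: "subgroup H G" unfolding H_def by (rule generate_is_subgroup[OF A(2)])
  have A_H: "A \<subseteq> H" by (auto simp: H_def intro: generate.incl)
  have "countable H" unfolding H_def using A by (intro countable_generate countable_finite)
  define f where "f = to_nat_on H"
  have inj: "inj_on f H" unfolding f_def by (rule inj_on_to_nat_on) fact
  define g where "g = inv_into H f"
  have gf [simp]: "g (f x) = x" if "x \<in> H" for x using that inj by (simp add: g_def)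
  define N :: "nat monoid" where
    "N = \<lparr>carrier = f ` H, monoid.mult = (\<lambda>x y. f (g x \<otimes> g y)), one = f \<one>\<rparr>"
  have N [simp]: "carrier N = f ` H" "x \<otimes>\<^bsub>N\<^esub> y = f (g x \<otimes> g y)" "\<one>\<^bsub>N\<^esub> = f \<one>" for x y
    by (simp_all add: N_def)
  have H_closed [simp]: "\<one> \<in> H" "x \<in> H \<Longrightarrow> y \<in> H \<Longrightarrow> x \<otimes> y \<in> H" "x \<in> H \<Longrightarrow> inv x \<in> H"
    "x \<in> H \<Longrightarrow> x \<in> carrier G" for x y
    using H by (auto simp: subgroup.one_closed subgroup.m_closed subgroup.m_inv_closed subgroup.mem_carrier)
  have N_group: "comm_group N"
  proof (rule comm_groupI)
    show "\<exists>y\<in>carrier N. y \<otimes>\<^bsub>N\<^esub> x = \<one>\<^bsub>N\<^esub>" if "x \<in> carrier N" for x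
    proof -
      obtain h where "h \<in> H" "x = f h" using \<open>x \<in> carrier N\<close> by auto
      then show ?thesis by (intro bexI[of _ "f (inv h)"]) auto
    qed
  qed (auto simp: m_ac)
  interpret N: comm_group N by fact
  have inv_f: "inv\<^bsub>N\<^esub> (f x) = f (inv x)" if "x \<in> H" for x
    by (rule N.inv_equality) (use that in auto)
  have f_eq: "f x = f y \<longleftrightarrow> x = y" if "x \<in> H" "y \<in> H" for x y
    using inj that by (auto simp: inj_on_def)
  have "additive_energy N (f ` A) = additive_energy G A"
  proof -
    have "bij_betw (\<lambda>(a, b, c, d). (f a, f b, f c, f d))
      {(a, b, c, d). a \<in> A \<and> b \<in> A \<and> c \<in> A \<and> d \<in> A \<and> a \<otimes> b = c \<otimes> d}
      {(a, b, c, d). a \<in> f ` A \<and> b \<in> f ` A \<and> c \<in> f ` A \<and> d \<in> f ` A \<and> a \<otimes>\<^bsub>N\<^esub> b = c \<otimes>\<^bsub>N\<^esub> d}"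
      using A_H
      by (intro bij_betw_byWitness[where f' = "\<lambda>(a, b, c, d). (g a, g b, g c, g d)"])
        (auto simp: f_eq subset_iff)
    then show ?thesis unfolding additive_energy_def by (rule bij_betw_same_card[symmetric])
  qed
  moreover have "card (difference_set N (f ` B)) = card (difference_set G B)" if "B \<subseteq> A" for B
  proof -
    have B: "x \<in> H" if "x \<in> B" for x using that \<open>B \<subseteq> A\<close> A_H by auto
    have "f a \<otimes>\<^bsub>N\<^esub> inv\<^bsub>N\<^esub> (f b) = f (a \<otimes> inv b)" if "a \<in> B" "b \<in> B" for a b
      using that B by (simp add: inv_f)
    then have "difference_set N (f ` B) = f ` difference_set G B"
      unfolding difference_set_def by (auto simp del: N) (metis imageI)+
    moreover have "inj_on f (difference_set G B)"
      using inj by (rule inj_on_subset) (auto simp: difference_set_def B)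
    ultimately show ?thesis by (simp add: card_image)
  qed
  ultimately show ?thesis
    using N_group inj A_H by (intro exI[of _ N] exI[of _ f]) (auto intro: inj_on_subset)
qed

theorem theorem1p8:
  fixes \<epsilon> K :: real and G :: "'a monoid" and A :: "'a set"
  assumes "\<epsilon> > 0"
    and "comm_group G"
    and "A \<subseteq> carrier G" and "finite A" and "A \<noteq> {}"
    and "K \<ge> 1"
    and "real (additive_energy G A) \<ge> inverse K * real (card A) ^ 3"
  shows "\<exists>A'\<subseteq>A.
    K powr (- 100 / 81 - \<epsilon>) * real (card A) \<le> energy_const \<epsilon> * real (card A') \<and>
    real (card (difference_set G A')) \<le>
      energy_const \<epsilon> * (K powr (100 / 27 + \<epsilon>) * real (card A'))"
proof -
  \<comment> \<open>\<open>energy_const_works\<close> speaks of groups on \<open>nat\<close> only;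
    the subset it provides in the copy is the image of some \<open>B \<subseteq> A\<close>.\<close>
  obtain N :: "nat monoid" and f where N: "comm_group N" "inj_on f A" "f ` A \<subseteq> carrier N"
    "additive_energy N (f ` A) = additive_energy G A"
    "\<And>B. B \<subseteq> A \<Longrightarrow> card (difference_set N (f ` B)) = card (difference_set G B)"
    using ex_nat_copy[OF assms(2,4,3)] by blast
  have card_f: "card (f ` B) = card B" if "B \<subseteq> A" for B
    using that N(2) by (metis card_image inj_on_subset)
  have "\<exists>A'\<subseteq>f ` A.
    K powr (- 100 / 81 - \<epsilon>) * real (card (f ` A)) \<le> energy_const \<epsilon> * real (card A') \<and>
    real (card (difference_set N A')) \<le>
      energy_const \<epsilon> * (K powr (100 / 27 + \<epsilon>) * real (card A'))"
    using assms N by (intro energy_const_works) (auto simp: card_f)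
  then obtain B where "B \<subseteq> A" and
    "K powr (- 100 / 81 - \<epsilon>) * real (card (f ` A)) \<le> energy_const \<epsilon> * real (card (f ` B))"
    "real (card (difference_set N (f ` B))) \<le>
      energy_const \<epsilon> * (K powr (100 / 27 + \<epsilon>) * real (card (f ` B)))"
    by (metis subset_image_iff)
  then show ?thesis by (intro exI[of _ B]) (simp add: card_f N(5))
qed

end
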